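(* Let $d$ be a positive integer and let $\Gamma$ be a weighted graph on a finite vertex set $V=X\sqcup Y$ with input vertices $X$ and output vertices $Y$, associated with a quantum error correcting code (so that $\mathbf{v}_\Gamma$ is an isometry). Then the isometry $\mathbf{v}_\Gamma: l_2(\mathbb{Z}_d^X)\to l_2(\mathbb{Z}_d^Y)$ fulfills the identity $$\mathbf{v}_\Gamma=d^{\frac{|X|}{2}}\,\mathbf{w}_X^*\,F_X\,\mathbf{u}_\Gamma\,F_X^*\,\mathbf{w}_Y .$$ In particular, the coding operation $C_\Gamma:\mathfrak{A}(Y)\otimes\mathfrak{C}(X)\to\mathfrak{A}(X)$ satisfies $$C_\Gamma=P_Y\circ\alpha_\Gamma\circ M_X .$$
   Context: Fix a positive integer $d$, and write $\mathbb{Z}_d$ for the cyclic group (ring) of integers mod $d$. For $g,h\in\mathbb{Z}_d$ put $\chi(g|h)=\exp\left(\frac{2\pi i}{d}gh\right)$, and for $\mathbf h,\mathbf h'\in\mathbb{Z}_d^K$ ($K$ a finite set) put $\chi(\mathbf h|\mathbf h')=\prod_{k\in K}\chi(h_k|h'_k)$. A weighted graph $\Gamma$ on a finite vertex set $V$ is a symmetric matrix $(\Gamma(i,j)\mid i,j\in V)$ of integers, with no self-links; $\Gamma(i,j)$ is the weight of the edge $\{i,j\}$ ($i\ne j$), and $\Gamma(i,j)=0$ means there is no edge. $V=X\sqcup Y$ is a partition into input vertices $X$ and output vertices $Y=V\setminus X$. $l_2(\mathbb{Z}_d^V)$ is the Hilbert space of complex functions on $\mathbb{Z}_d^V$ with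 orthonormal (computational) basis $|\mathbf g\rangle$, $\mathbf g\in\mathbb{Z}_d^V$; $l_2(\mathbb{Z}_d^V)$ is identified with $l_2(\mathbb{Z}_d^X)\otimes l_2(\mathbb{Z}_d^Y)$, with basis vectors written $|\mathbf h,\mathbf g\rangle$, $\mathbf h\in\mathbb{Z}_d^X$, $\mathbf g\in\mathbb{Z}_d^Y$. Gates on $l_2(\mathbb{Z}_d^V)$: the local Fourier transform $F_i$ is the unitary $F_i|\mathbf g\rangle=\frac1{\sqrt d}\sum_{h\in\mathbb{Z}_d}\chi(g_i|h)|h,\mathbf g^i\rangle$ ($i$-th entry replaced by $h$); $F_K=\prod_{k\in K}F_k$ for $K\subset V$. The $n$-controlled shift gate ($n\in\mathbb{Z}$, $i\neq j$) is the unitary $\mathbf c(i,j)^n$ replacing the $j$-th entry $g_j$ of $|\mathbf g\rangle$ by $g_j+ng_i$. The $n$-controlled phase gate is $\mathbf u(i,j)^n=F_j\mathbf c(i,j)^nF_j^*=F_i\mathbf c(j,i)^nF_i^*$, which maps $|\mathbf g\rangle$ to $\chi(g_i|g_j)^n|\mathbf g\rangle$. The cluster state creation operator is $\mathbf u_\Gamma=\left(\prod_{\{i,j\}\subset V}\mathbf u(i,j)^{\Gamma(i,j)}\right)\prod_{j\in V}F_j$ (first product over all two-element subsets of $V$). Cluster state wave function: $\Psi_\Gamma(\mathbf g)=d^{-\frac12|V|}\prod_{\{i,j\}\subset V}\chi(g_i|g_j)^{\Gamma(i,j)}$ for $\mathbf g\in\mathbb{Z}_d^V$. Graph code: $\mathbf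 v_\Gamma:l_2(\mathbb{Z}_d^X)\to l_2(\mathbb{Z}_d^Y)$ is the linear map with $\mathbf v_\Gamma|\mathbf h\rangle=d^{\frac12|X|}\sum_{\mathbf g\in\mathbb{Z}_d^Y}\Psi_\Gamma(\mathbf h,\mathbf g)|\mathbf g\rangle$ for $\mathbf h\in\mathbb{Z}_d^X$. The weighted graph $\Gamma$ (with the chosen inputs and outputs) being associated with a quantum error correcting code is understood to mean that $\mathbf v_\Gamma$ is an isometry, $\mathbf v_\Gamma^*\mathbf v_\Gamma=1$ (its range being the code subspace). For $K\subset V$, $\mathbf w_K: l_2(\mathbb{Z}_d^{V\setminus K})\to l_2(\mathbb{Z}_d^V)$ is the isometry $\mathbf w_K\Psi=|\mathbf 0_K\rangle\otimes\Psi$, where $\mathbf 0_K$ is the zero of $\mathbb{Z}_d^K$. So $\mathbf w_X: l_2(\mathbb{Z}_d^Y)\to l_2(\mathbb{Z}_d^V)$ and $\mathbf w_Y: l_2(\mathbb{Z}_d^X)\to l_2(\mathbb{Z}_d^V)$. Shifts and multipliers: for $\mathbf h\in\mathbb{Z}_d^X$, viewed as an element of $\mathbb{Z}_d^V$ by extending by zero, $\mathbf u(\mathbf h)$ is the unitary on $l_2(\mathbb{Z}_d^V)$ given by $\mathbf u(\mathbf h)|\mathbf h'\rangle=|\mathbf h'+\mathbf h\rangle$. The multiplier $\hat{\mathbf u}(\mathbf h)$ on $l_2(\mathbb{Z}_d^X)$ is $\hat{\mathbf u}(\mathbf h)|\mathbf h'\rangle=\chi(\mathbf h|\mathbf h')|\mathbf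 h'\rangle$, $\mathbf h'\in\mathbb{Z}_d^X$. Algebras: $\mathfrak A(K)$ is the algebra of all bounded operators on $l_2(\mathbb{Z}_d^K)$; $\mathfrak C(K)$ is the abelian algebra of complex functions on $\mathbb{Z}_d^K$. Maps (defined on elementary tensors $a\otimes f$, $a\in\mathfrak A(Y)$, $f\in\mathfrak C(X)$, and extended linearly where applicable): - $C_\Gamma:\mathfrak A(Y)\otimes\mathfrak C(X)\to\mathfrak A(X)$, $C_\Gamma(a\otimes f)=d^{-|X|}\sum_{\mathbf h\in\mathbb{Z}_d^X}\hat{\mathbf u}(\mathbf h)^*\mathbf v_\Gamma^*\,a\,\mathbf v_\Gamma\hat{\mathbf u}(\mathbf h)\,f(\mathbf h)$. - $M_X:\mathfrak A(Y)\otimes\mathfrak C(X)\to\mathfrak A(V)$, $M_X(a\otimes f)=\sum_{\mathbf h\in\mathbb{Z}_d^X}\mathbf u(\mathbf h)\mathbf w_X\,a\,\mathbf w_X^*\mathbf u(\mathbf h)^*\,f(\mathbf h)$. - $\alpha_\Gamma:\mathfrak A(V)\to\mathfrak A(V)$, $\alpha_\Gamma(b)=F_X\mathbf u_\Gamma^*F_X^*\,b\,F_X\mathbf u_\Gamma F_X^*$. - $P_Y:\mathfrak A(V)\to\mathfrak A(X)$, $P_Y(b)=\mathbf w_Y^*\,b\,\mathbf w_Y$. *)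

theory Defs
  imports Complex_Main "HOL-Library.FuncSet"
begin

text \<open>
  The group of integers mod \<open>d\<close> is represented by the residues \<open>0, \<dots>, d - 1\<close>, and its power with
  exponent \<open>K\<close> by the extensional functions on \<open>K\<close>. A vector of \<open>l\<^sub>2\<close> over that power is a complex
  function of configurations which vanishes off them.
\<close>

definition Zd :: "nat \<Rightarrow> int set" where
  "Zd d = {0..<int d}"

definition cfg :: "nat \<Rightarrow> 'v set \<Rightarrow> ('v \<Rightarrow> int) set" where
  "cfg d K = (K \<rightarrow>\<^sub>E Zd d)"

definition chi :: "nat \<Rightarrow> int \<Rightarrow> int \<Rightarrow> complex" where
  "chi d g h = exp (2 * complex_of_real pi * \<i> / of_nat d * of_int g * of_int h)"

definition chi_on :: "nat \<Rightarrow> 'v set \<Rightarrow> ('v \<Rightarrow> int) \<Rightarrow> ('v \<Rightarrow> int) \<Rightarrow> complex" where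
  "chi_on d K h h' = (\<Prod>k\<in>K. chi d (h k) (h' k))"

type_synonym 'v vec = "('v \<Rightarrow> int) \<Rightarrow> complex"
type_synonym 'v oper = "'v vec \<Rightarrow> 'v vec"

definition l2 :: "nat \<Rightarrow> 'v set \<Rightarrow> 'v vec set" where
  "l2 d K = {\<psi>. \<forall>g. g \<notin> cfg d K \<longrightarrow> \<psi> g = 0}"

definition inner_l2 :: "nat \<Rightarrow> 'v set \<Rightarrow> 'v vec \<Rightarrow> 'v vec \<Rightarrow> complex" where
  "inner_l2 d K \<phi> \<psi> = (\<Sum>g\<in>cfg d K. cnj (\<phi> g) * \<psi> g)"

definition ket :: "('v \<Rightarrow> int) \<Rightarrow> 'v vec" where
  "ket g = (\<lambda>k. if k = g then 1 else 0)"


text \<open>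
  Operators between these spaces are linear maps; only their values on the domain \<open>l2 d K\<close> are
  meaningful. The spaces are finite-dimensional, so boundedness is automatic.
\<close>

definition operators :: "nat \<Rightarrow> 'v set \<Rightarrow> 'v set \<Rightarrow> 'v oper set" where
  "operators d K L = {T. (\<forall>\<psi>\<in>l2 d K. T \<psi> \<in> l2 d L) \<and>
     (\<forall>\<phi>\<in>l2 d K. \<forall>\<psi>\<in>l2 d K. T (\<lambda>g. \<phi> g + \<psi> g) = (\<lambda>g. T \<phi> g + T \<psi> g)) \<and>
     (\<forall>c. \<forall>\<psi>\<in>l2 d K. T (\<lambda>g. c * \<psi> g) = (\<lambda>g. c * T \<psi> g))}"

abbreviation algebra_A :: "nat \<Rightarrow> 'v set \<Rightarrow> 'v oper set" where
  "algebra_A d K \<equiv> operators d K K"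

text \<open>The linear map on \<open>l2 d K\<close> with prescribed images \<open>b g\<close> of the basis vectors \<open>ket g\<close>.\<close>

definition lin :: "nat \<Rightarrow> 'v set \<Rightarrow> (('v \<Rightarrow> int) \<Rightarrow> 'v vec) \<Rightarrow> 'v oper" where
  "lin d K b \<psi> = (\<lambda>k. \<Sum>g\<in>cfg d K. \<psi> g * b g k)"

text \<open>The adjoint of an operator from \<open>l2 d K\<close> to \<open>l2 d L\<close>.\<close>

definition adj :: "nat \<Rightarrow> 'v set \<Rightarrow> 'v set \<Rightarrow> 'v oper \<Rightarrow> 'v oper" where
  "adj d K L T \<phi> =
     (THE \<xi>. \<xi> \<in> l2 d K \<and> (\<forall>\<psi>\<in>l2 d K. inner_l2 d K \<xi> \<psi> = inner_l2 d L \<phi> (T \<psi>)))"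

definition op_scale :: "complex \<Rightarrow> 'v oper \<Rightarrow> 'v oper" where
  "op_scale c T \<psi> = (\<lambda>g. c * T \<psi> g)"

definition op_sum :: "('i \<Rightarrow> 'v oper) \<Rightarrow> 'i set \<Rightarrow> 'v oper" where
  "op_sum T A \<psi> = (\<lambda>g. \<Sum>i\<in>A. T i \<psi> g)"

text \<open>Product of pairwise commuting operators indexed by a finite set.\<close>

definition op_prod :: "('i \<Rightarrow> 'v oper) \<Rightarrow> 'i set \<Rightarrow> 'v oper" where
  "op_prod T A = Finite_Set.fold (\<lambda>i S. T i \<circ> S) id A"

definition is_isometry :: "nat \<Rightarrow> 'v set \<Rightarrow> 'v set \<Rightarrow> 'v oper \<Rightarrow> bool" where
  "is_isometry d K L T \<longleftrightarrow>
     T \<in> operators d K L \<and> (\<forall>\<psi>\<in>l2 d K. (adj d K L T \<circ> T) \<psi> = \<psi>)"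


definition weighted_graph :: "'v set \<Rightarrow> ('v \<Rightarrow> 'v \<Rightarrow> int) \<Rightarrow> bool" where
  "weighted_graph V \<Gamma> \<longleftrightarrow>
     finite V \<and> (\<forall>i\<in>V. \<forall>j\<in>V. \<Gamma> i j = \<Gamma> j i) \<and> (\<forall>i\<in>V. \<Gamma> i i = 0)"

definition pairs :: "'v set \<Rightarrow> 'v set set" where
  "pairs V = {e. e \<subseteq> V \<and> card e = 2}"

text \<open>The value at the unordered pair \<open>e = {i, j}\<close> of a quantity \<open>f i j\<close> symmetric in \<open>i, j\<close>.\<close>

definition on_pair :: "('v \<Rightarrow> 'v \<Rightarrow> 'b) \<Rightarrow> 'v set \<Rightarrow> 'b" where
  "on_pair f e = (THE z. \<exists>i j. i \<noteq> j \<and> e = {i, j} \<and> z = f i j)"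


definition fourier :: "nat \<Rightarrow> 'v set \<Rightarrow> 'v \<Rightarrow> 'v oper" where
  "fourier d V i = lin d V (\<lambda>g k.
     complex_of_real (1 / sqrt (real d)) * (\<Sum>h\<in>Zd d. chi d (g i) h * ket (g(i := h)) k))"

definition fourier_set :: "nat \<Rightarrow> 'v set \<Rightarrow> 'v set \<Rightarrow> 'v oper" where
  "fourier_set d V K = op_prod (fourier d V) K"

definition ctrl_shift :: "nat \<Rightarrow> 'v set \<Rightarrow> 'v \<Rightarrow> 'v \<Rightarrow> int \<Rightarrow> 'v oper" where
  "ctrl_shift d V i j n = lin d V (\<lambda>g. ket (g(j := (g j + n * g i) mod int d)))"

definition ctrl_phase :: "nat \<Rightarrow> 'v set \<Rightarrow> 'v \<Rightarrow> 'v \<Rightarrow> int \<Rightarrow> 'v oper" where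
  "ctrl_phase d V i j n = fourier d V j \<circ> ctrl_shift d V i j n \<circ> adj d V V (fourier d V j)"

definition cluster_op :: "nat \<Rightarrow> 'v set \<Rightarrow> ('v \<Rightarrow> 'v \<Rightarrow> int) \<Rightarrow> 'v oper" where
  "cluster_op d V \<Gamma> =
     op_prod (on_pair (\<lambda>i j. ctrl_phase d V i j (\<Gamma> i j))) (pairs V) \<circ> fourier_set d V V"

definition wave_function :: "nat \<Rightarrow> 'v set \<Rightarrow> ('v \<Rightarrow> 'v \<Rightarrow> int) \<Rightarrow> ('v \<Rightarrow> int) \<Rightarrow> complex" where
  "wave_function d V \<Gamma> g = complex_of_real (real d powr (- (1/2) * real (card V))) *
     (\<Prod>e\<in>pairs V. on_pair (\<lambda>i j. chi d (g i) (g j) powi \<Gamma> i j) e)"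

text \<open>
  The pair of \<open>h \<in> cfg d X\<close> and \<open>g \<in> cfg d (V - X)\<close>, as a configuration on \<open>V\<close>, is
  \<open>override_on g h X\<close>.
\<close>

definition graph_code :: "nat \<Rightarrow> 'v set \<Rightarrow> 'v set \<Rightarrow> ('v \<Rightarrow> 'v \<Rightarrow> int) \<Rightarrow> 'v oper" where
  "graph_code d V X \<Gamma> = lin d X (\<lambda>h k.
     complex_of_real (real d powr ((1/2) * real (card X))) *
       (\<Sum>g\<in>cfg d (V - X). wave_function d V \<Gamma> (override_on g h X) * ket g k))"

definition tensor_vec :: "nat \<Rightarrow> 'v set \<Rightarrow> 'v set \<Rightarrow> 'v vec \<Rightarrow> 'v vec \<Rightarrow> 'v vec" where
  "tensor_vec d K L \<phi> \<psi> = (\<lambda>g. if g \<in> cfg d (K \<union> L)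
     then \<phi> (restrict g K) * \<psi> (restrict g L) else 0)"

definition embed :: "nat \<Rightarrow> 'v set \<Rightarrow> 'v set \<Rightarrow> 'v oper" where
  "embed d V K \<psi> = tensor_vec d K (V - K) (ket (\<lambda>i\<in>K. 0)) \<psi>"

definition embed_adj :: "nat \<Rightarrow> 'v set \<Rightarrow> 'v set \<Rightarrow> 'v oper" where
  "embed_adj d V K = adj d (V - K) V (embed d V K)"

definition cfg_add :: "nat \<Rightarrow> 'v set \<Rightarrow> ('v \<Rightarrow> int) \<Rightarrow> ('v \<Rightarrow> int) \<Rightarrow> 'v \<Rightarrow> int" where
  "cfg_add d V g h = (\<lambda>i\<in>V. (g i + h i) mod int d)"

definition zero_ext :: "'v set \<Rightarrow> 'v set \<Rightarrow> ('v \<Rightarrow> int) \<Rightarrow> 'v \<Rightarrow> int" where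
  "zero_ext V X h = (\<lambda>i\<in>V. if i \<in> X then h i else 0)"

definition shift :: "nat \<Rightarrow> 'v set \<Rightarrow> 'v set \<Rightarrow> ('v \<Rightarrow> int) \<Rightarrow> 'v oper" where
  "shift d V X h = lin d V (\<lambda>h'. ket (cfg_add d V h' (zero_ext V X h)))"

definition multiplier :: "nat \<Rightarrow> 'v set \<Rightarrow> ('v \<Rightarrow> int) \<Rightarrow> 'v oper" where
  "multiplier d X h = lin d X (\<lambda>h' k. chi_on d X h h' * ket h' k)"


text \<open>
  The tensor product of \<open>algebra_A d Y\<close> with the functions on \<open>cfg d X\<close> is the space of functions on
  \<open>cfg d X\<close> with values in \<open>algebra_A d Y\<close>. Since each \<open>T\<close> in it is the sum over \<open>k\<close> of the elementary
  tensors of \<open>T k\<close> with the indicator of \<open>k\<close> (which is \<open>ket k\<close>), a map given by a bilinear \<open>\<Phi> a f\<close>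
  on elementary tensors has \<open>tensor_ext d X \<Phi>\<close> as its linear extension.
\<close>

definition tensor_alg :: "nat \<Rightarrow> 'v set \<Rightarrow> 'v set \<Rightarrow> (('v \<Rightarrow> int) \<Rightarrow> 'v oper) set" where
  "tensor_alg d Y X = (cfg d X \<rightarrow> algebra_A d Y)"

definition elem_tensor :: "'v oper \<Rightarrow> 'v vec \<Rightarrow> ('v \<Rightarrow> int) \<Rightarrow> 'v oper" where
  "elem_tensor a f = (\<lambda>k. op_scale (f k) a)"

definition tensor_ext ::
  "nat \<Rightarrow> 'v set \<Rightarrow> ('v oper \<Rightarrow> 'v vec \<Rightarrow> 'v oper) \<Rightarrow> (('v \<Rightarrow> int) \<Rightarrow> 'v oper) \<Rightarrow> 'v oper" where
  "tensor_ext d X \<Phi> T = op_sum (\<lambda>k. \<Phi> (T k) (ket k)) (cfg d X)"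

definition coding_elem ::
  "nat \<Rightarrow> 'v set \<Rightarrow> 'v set \<Rightarrow> ('v \<Rightarrow> 'v \<Rightarrow> int) \<Rightarrow> 'v oper \<Rightarrow> 'v vec \<Rightarrow> 'v oper" where
  "coding_elem d V X \<Gamma> a f = op_scale (1 / of_nat d ^ card X)
     (op_sum (\<lambda>h. op_scale (f h)
        (adj d X X (multiplier d X h) \<circ> adj d X (V - X) (graph_code d V X \<Gamma>) \<circ> a \<circ>
         graph_code d V X \<Gamma> \<circ> multiplier d X h)) (cfg d X))"

definition coding ::
  "nat \<Rightarrow> 'v set \<Rightarrow> 'v set \<Rightarrow> ('v \<Rightarrow> 'v \<Rightarrow> int) \<Rightarrow> (('v \<Rightarrow> int) \<Rightarrow> 'v oper) \<Rightarrow> 'v oper" where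
  "coding d V X \<Gamma> = tensor_ext d X (coding_elem d V X \<Gamma>)"

definition M_elem :: "nat \<Rightarrow> 'v set \<Rightarrow> 'v set \<Rightarrow> 'v oper \<Rightarrow> 'v vec \<Rightarrow> 'v oper" where
  "M_elem d V X a f = op_sum (\<lambda>h. op_scale (f h)
     (shift d V X h \<circ> embed d V X \<circ> a \<circ> embed_adj d V X \<circ> adj d V V (shift d V X h))) (cfg d X)"

definition M_op :: "nat \<Rightarrow> 'v set \<Rightarrow> 'v set \<Rightarrow> (('v \<Rightarrow> int) \<Rightarrow> 'v oper) \<Rightarrow> 'v oper" where
  "M_op d V X = tensor_ext d X (M_elem d V X)"

definition alpha ::
  "nat \<Rightarrow> 'v set \<Rightarrow> 'v set \<Rightarrow> ('v \<Rightarrow> 'v \<Rightarrow> int) \<Rightarrow> 'v oper \<Rightarrow> 'v oper" where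
  "alpha d V X \<Gamma> b =
     fourier_set d V X \<circ> adj d V V (cluster_op d V \<Gamma>) \<circ> adj d V V (fourier_set d V X) \<circ> b \<circ>
     fourier_set d V X \<circ> cluster_op d V \<Gamma> \<circ> adj d V V (fourier_set d V X)"

definition P_op :: "nat \<Rightarrow> 'v set \<Rightarrow> 'v set \<Rightarrow> 'v oper \<Rightarrow> 'v oper" where
  "P_op d V Y b = embed_adj d V Y \<circ> b \<circ> embed d V Y"


text \<open>The adjoint exists, and \<open>tensor_ext\<close> agrees with the formulas on elementary tensors.\<close>

lemma finite_cfg: "finite K \<Longrightarrow> finite (cfg d K)"
  by (auto simp: cfg_def Zd_def intro: finite_PiE)

lemma ket_in_l2: "g \<in> cfg d K \<Longrightarrow> ket g \<in> l2 d K"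
  by (auto simp: ket_def l2_def)

lemma operators_add:
  "T \<in> operators d K L \<Longrightarrow> \<phi> \<in> l2 d K \<Longrightarrow> \<psi> \<in> l2 d K \<Longrightarrow>
    T (\<lambda>g. \<phi> g + \<psi> g) = (\<lambda>g. T \<phi> g + T \<psi> g)"
  unfolding operators_def by blast

lemma operators_scale:
  "T \<in> operators d K L \<Longrightarrow> \<psi> \<in> l2 d K \<Longrightarrow> T (\<lambda>g. c * \<psi> g) = (\<lambda>g. c * T \<psi> g)"
  unfolding operators_def by blast

lemma operators_expand:
  assumes T: "T \<in> operators d K L" and K: "finite K" and \<psi>: "\<psi> \<in> l2 d K"
  shows "T \<psi> = lin d K (\<lambda>g. T (ket g)) \<psi>"
proof -
  have z: "T (\<lambda>g. 0) = (\<lambda>g. 0)"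
  proof -
    have "(\<lambda>g. 0) \<in> l2 d K" by (simp add: l2_def)
    from operators_scale[OF T this, of 0] show ?thesis by simp
  qed
  have "T (\<lambda>k. \<Sum>g\<in>A. \<psi> g * ket g k) = (\<lambda>k. \<Sum>g\<in>A. \<psi> g * T (ket g) k)"
    if "finite A" "A \<subseteq> cfg d K" for A
    using that
  proof (induction A rule: finite_induct)
    case empty then show ?case by (simp add: z)
  next
    case (insert x A)
    have x: "ket x \<in> l2 d K" using insert by (simp add: ket_in_l2)
    have 1: "(\<lambda>k. \<psi> x * ket x k) \<in> l2 d K" using x by (simp add: l2_def)
    have 2: "(\<lambda>k. \<Sum>g\<in>A. \<psi> g * ket g k) \<in> l2 d K"
      using insert.prems by (auto simp: l2_def ket_def intro!: sum.neutral)
    have "T (\<lambda>k. \<psi> x * ket x k + (\<Sum>g\<in>A. \<psi> g * ket g k))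
        = (\<lambda>k. T (\<lambda>k. \<psi> x * ket x k) k + T (\<lambda>k. \<Sum>g\<in>A. \<psi> g * ket g k) k)"
      by (rule operators_add[OF T 1 2])
    moreover have "T (\<lambda>k. \<psi> x * ket x k) = (\<lambda>k. \<psi> x * T (ket x) k)"
      by (rule operators_scale[OF T x])
    ultimately show ?case using insert by simp
  qed
  note this[OF finite_cfg[OF K] order_refl]
  moreover have "(\<lambda>k. \<Sum>g\<in>cfg d K. \<psi> g * ket g k) = \<psi>"
  proof
    fix k
    have "(\<Sum>g\<in>cfg d K. \<psi> g * ket g k) = (\<Sum>g\<in>cfg d K. if g = k then \<psi> k else 0)"
      by (rule sum.cong) (auto simp: ket_def)
    then show "(\<Sum>g\<in>cfg d K. \<psi> g * ket g k) = \<psi> k"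
      using \<psi> finite_cfg[OF K] by (auto simp: sum.delta l2_def)
  qed
  ultimately show ?thesis by (simp add: lin_def)
qed

lemma adj_eqI:
  assumes K: "finite K" and \<xi>: "\<xi> \<in> l2 d K"
    and eq: "\<And>\<psi>. \<psi> \<in> l2 d K \<Longrightarrow> inner_l2 d K \<xi> \<psi> = inner_l2 d L \<phi> (T \<psi>)"
  shows "adj d K L T \<phi> = \<xi>"
  unfolding adj_def
proof (rule the_equality)
  show "\<xi> \<in> l2 d K \<and> (\<forall>\<psi>\<in>l2 d K. inner_l2 d K \<xi> \<psi> = inner_l2 d L \<phi> (T \<psi>))"
    using \<xi> eq by blast
next
  fix \<zeta> assume \<zeta>: "\<zeta> \<in> l2 d K \<and> (\<forall>\<psi>\<in>l2 d K. inner_l2 d K \<zeta> \<psi> = inner_l2 d L \<phi> (T \<psi>))"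
  have ik: "inner_l2 d K v (ket g) = cnj (v g)" if "g \<in> cfg d K" for v g
  proof -
    have "inner_l2 d K v (ket g) = (\<Sum>k\<in>cfg d K. if k = g then cnj (v g) else 0)"
      unfolding inner_l2_def by (rule sum.cong) (auto simp: ket_def)
    then show ?thesis using that finite_cfg[OF K] by (simp add: sum.delta)
  qed
  show "\<zeta> = \<xi>"
  proof
    fix g show "\<zeta> g = \<xi> g"
    proof (cases "g \<in> cfg d K")
      case True
      then have "cnj (\<zeta> g) = cnj (\<xi> g)"
        using \<zeta> eq ket_in_l2[OF True] ik[OF True] by metis
      then show ?thesis by simp
    next
      case False then show ?thesis using \<zeta> \<xi> by (simp add: l2_def)
    qed
  qed
qed

lemma adj_eq:
  assumes T: "T \<in> operators d K L" and K: "finite K"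
  shows "adj d K L T \<phi> = (\<lambda>g. if g \<in> cfg d K then \<Sum>k\<in>cfg d L. cnj (T (ket g) k) * \<phi> k else 0)"
proof (rule adj_eqI[OF K])
  show "(\<lambda>g. if g \<in> cfg d K then \<Sum>k\<in>cfg d L. cnj (T (ket g) k) * \<phi> k else 0) \<in> l2 d K"
    by (simp add: l2_def)
next
  fix \<psi> assume \<psi>: "\<psi> \<in> l2 d K"
  have "inner_l2 d L \<phi> (T \<psi>) = (\<Sum>k\<in>cfg d L. \<Sum>g\<in>cfg d K. cnj (\<phi> k) * (\<psi> g * T (ket g) k))"
    by (subst operators_expand[OF T K \<psi>]) (simp add: inner_l2_def lin_def sum_distrib_left)
  also have "\<dots> = (\<Sum>g\<in>cfg d K. \<Sum>k\<in>cfg d L. cnj (\<phi> k) * (\<psi> g * T (ket g) k))"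
    by (rule sum.swap)
  finally show "inner_l2 d K
      (\<lambda>g. if g \<in> cfg d K then \<Sum>k\<in>cfg d L. cnj (T (ket g) k) * \<phi> k else 0) \<psi>
      = inner_l2 d L \<phi> (T \<psi>)"
    by (simp add: inner_l2_def sum_distrib_left sum_distrib_right mult_ac)
qed

lemma adj_inner:
  assumes T: "T \<in> operators d K L" and K: "finite K" and \<psi>: "\<psi> \<in> l2 d K"
  shows "inner_l2 d K (adj d K L T \<phi>) \<psi> = inner_l2 d L \<phi> (T \<psi>)"
proof -
  have "inner_l2 d L \<phi> (T \<psi>) = (\<Sum>k\<in>cfg d L. \<Sum>g\<in>cfg d K. cnj (\<phi> k) * (\<psi> g * T (ket g) k))"
    by (subst operators_expand[OF T K \<psi>]) (simp add: inner_l2_def lin_def sum_distrib_left)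
  also have "\<dots> = (\<Sum>g\<in>cfg d K. \<Sum>k\<in>cfg d L. cnj (\<phi> k) * (\<psi> g * T (ket g) k))"
    by (rule sum.swap)
  finally show ?thesis
    by (simp add: adj_eq[OF T K] inner_l2_def sum_distrib_left sum_distrib_right mult_ac)
qed

lemma lin_operator:
  assumes "\<And>g. g \<in> cfg d K \<Longrightarrow> b g \<in> l2 d L"
  shows "lin d K b \<in> operators d K L"
  unfolding operators_def
  using assms
  by (auto simp: lin_def l2_def sum.distrib distrib_left sum_distrib_left mult_ac
      intro!: sum.neutral ext)

lemma graph_code_operator: "graph_code d V X \<Gamma> \<in> operators d X (V - X)"
  unfolding graph_code_def
  by (rule lin_operator) (auto simp: l2_def ket_def intro!: sum.neutral)

lemma multiplier_operator: "multiplier d X h \<in> operators d X X"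
  unfolding multiplier_def by (rule lin_operator) (auto simp: l2_def ket_def)

lemma shift_operator:
  assumes "d > 0" shows "shift d V X h \<in> operators d V V"
  unfolding shift_def
  using assms by (intro lin_operator ket_in_l2) (auto simp: cfg_add_def cfg_def Zd_def)

lemma embed_operator:
  assumes "K \<subseteq> V" shows "embed d V K \<in> operators d (V - K) V"
proof -
  have "K \<union> (V - K) = V" using assms by blast
  then show ?thesis
    by (auto simp: operators_def embed_def tensor_vec_def l2_def algebra_simps)
qed

lemma adj_scale:
  assumes "T \<in> operators d K L" and "finite K"
  shows "adj d K L T (\<lambda>g. c * \<phi> g) = (\<lambda>g. c * adj d K L T \<phi> g)"
  by (auto simp: adj_eq[OF assms] sum_distrib_left mult_ac)

lemma operators_closed: "T \<in> operators d K L \<Longrightarrow> \<psi> \<in> l2 d K \<Longrightarrow> T \<psi> \<in> l2 d L"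
  unfolding operators_def by blast

lemma adj_closed:
  "T \<in> operators d K L \<Longrightarrow> finite K \<Longrightarrow> adj d K L T \<phi> \<in> l2 d K"
  by (simp add: adj_eq l2_def)

lemma coding_elem_tensor:
  assumes X: "finite X" and \<psi>: "\<psi> \<in> l2 d X"
  shows "coding d V X \<Gamma> (elem_tensor a f) \<psi> = coding_elem d V X \<Gamma> a f \<psi>"
proof -
  let ?R = "\<lambda>h g. (adj d X X (multiplier d X h) \<circ> adj d X (V - X) (graph_code d V X \<Gamma>) \<circ> a \<circ>
         graph_code d V X \<Gamma> \<circ> multiplier d X h) \<psi> g"
  have 1: "coding_elem d V X \<Gamma> (op_scale (f k) a) (ket k) \<psi> g
      = (1 / of_nat d ^ card X) * (f k * ?R k g)" if "k \<in> cfg d X" for k g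
  proof -
    have "coding_elem d V X \<Gamma> (op_scale (f k) a) (ket k) \<psi> g
       = (1 / of_nat d ^ card X) * (\<Sum>h\<in>cfg d X. ket k h * (f k * ?R h g))"
      by (simp add: coding_elem_def op_scale_def op_sum_def o_def
          adj_scale[OF graph_code_operator X] adj_scale[OF multiplier_operator X])
    also have "(\<Sum>h\<in>cfg d X. ket k h * (f k * ?R h g))
       = (\<Sum>h\<in>cfg d X. if h = k then f k * ?R k g else 0)"
      by (rule sum.cong) (auto simp: ket_def)
    finally show ?thesis using that finite_cfg[OF X] by (simp add: sum.delta)
  qed
  show ?thesis
    by (rule ext)
      (simp add: coding_def tensor_ext_def op_sum_def elem_tensor_def 1,
       simp add: coding_elem_def op_scale_def op_sum_def sum_distrib_left)
qed

lemma M_elem_tensor: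
  assumes d: "d > 0" and V: "finite V" and XV: "X \<subseteq> V"
    and a: "a \<in> algebra_A d (V - X)"
  shows "M_op d V X (elem_tensor a f) \<psi> = M_elem d V X a f \<psi>"
proof -
  have X: "finite X" using V XV by (rule rev_finite_subset)
  let ?R = "\<lambda>h g. (shift d V X h \<circ> embed d V X \<circ> a \<circ> embed_adj d V X \<circ>
    adj d V V (shift d V X h)) \<psi> g"
  have ea: "embed_adj d V X \<phi> \<in> l2 d (V - X)" for \<phi>
    unfolding embed_adj_def using V by (intro adj_closed embed_operator XV) simp
  have 1: "M_elem d V X (op_scale (f k) a) (ket k) \<psi> g = f k * ?R k g"
    if "k \<in> cfg d X" for k g
  proof -
    have "M_elem d V X (op_scale (f k) a) (ket k) \<psi> g
       = (\<Sum>h\<in>cfg d X. ket k h * (f k * ?R h g))"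
      by (simp add: M_elem_def op_scale_def op_sum_def o_def
          operators_scale[OF embed_operator[OF XV]] operators_scale[OF shift_operator[OF d]]
          operators_closed[OF a] operators_closed[OF embed_operator[OF XV]] ea)
    also have "\<dots> = (\<Sum>h\<in>cfg d X. if h = k then f k * ?R k g else 0)"
      by (rule sum.cong) (auto simp: ket_def)
    finally show ?thesis using that finite_cfg[OF X] by (simp add: sum.delta)
  qed
  show ?thesis
    by (rule ext)
      (simp add: M_op_def tensor_ext_def op_sum_def elem_tensor_def 1,
       simp add: M_elem_def op_scale_def op_sum_def)
qed

end

theory Submission
  imports Defs "HOL-Library.Real_Mod"
begin

text \<open>
  Write \<open>A = F\<^sub>X u\<^sub>\<Gamma> F\<^sub>X\<^sup>* w\<^sub>Y\<close> and \<open>B\<^sub>h = u(h) w\<^sub>X\<close>. Since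
  \<open>F\<^sub>V = F\<^sub>Y F\<^sub>X\<close>, the transforms over \<open>X\<close> inside \<open>u\<^sub>\<Gamma> F\<^sub>X\<^sup>*\<close> cancel, and \<open>F\<^sub>Y\<close> turns \<open>0\<^sub>Y\<close> into the uniform superposition, which the phase gates
  weight by the wave function. The remaining \<open>F\<^sub>X\<close> followed by \<open>B\<^sub>h\<^sup>*\<close>, which selects the component
  \<open>h\<close> on \<open>X\<close>, contributes the character \<open>\<chi>(h|\<cdot>)\<close>. Hence \<open>d\<^bsup>|X|/2\<^esup> B\<^sub>h\<^sup>* A\<close> is \<open>v\<^sub>\<Gamma>\<close> composed with
  the multiplier of \<open>h\<close>: the first claim is the case \<open>h = 0\<close>, and the second follows by taking
  adjoints term by term.
\<close>

section \<open>Characters\<close>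

lemma chi_cis: "chi d g h = cis (2 * pi * of_int g * of_int h / of_nat d)"
  by (simp add: chi_def cis_conv_exp mult_ac)

lemma chi_commute: "chi d g h = chi d h g"
  by (simp add: chi_cis mult_ac)

lemma chi_0 [simp]: "chi d 0 h = 1" "chi d h 0 = 1"
  by (simp_all add: chi_cis)

lemma chi_add_left: "chi d (g + g') h = chi d g h * chi d g' h"
  by (simp add: chi_cis cis_mult add_divide_distrib algebra_simps)

lemma cnj_chi: "cnj (chi d g h) = chi d (- g) h"
  by (simp add: chi_cis cis_cnj)

lemma chi_mult_left: "chi d (n * g) h = chi d g h powi n"
  by (simp add: chi_cis cis_power_int mult_ac)

text \<open>A multiple of \<open>d\<close> in one argument contributes whole turns of the circle, so
  \<open>chi\<close>, given by a formula on integers, is a character of the residue group and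
  reductions modulo \<open>d\<close> may be dropped inside it.\<close>

lemma chi_mod_left: "d > 0 \<Longrightarrow> chi d (g mod int d) h = chi d g h"
proof -
  assume d: "d > 0"
  have "chi d (int d * (g div int d)) h = cis (2 * pi * of_int (g div int d * h))"
    using d by (simp add: chi_cis mult_ac)
  also have "\<dots> = 1" by (rule cis_multiple_2pi) simp
  finally have "chi d (int d * (g div int d)) h = 1" .
  then show ?thesis
    using chi_add_left[of d "g mod int d" "int d * (g div int d)" h] by simp
qed

lemma chi_on_commute: "chi_on d K g h = chi_on d K h g"
  by (simp add: chi_on_def chi_commute)

lemma finite_Zd [simp]: "finite (Zd d)"
  by (simp add: Zd_def)

lemma mod_in_Zd: "d > 0 \<Longrightarrow> n mod int d \<in> Zd d"
  by (simp add: Zd_def)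

text \<open>The sum is a geometric series whose ratio is a \<open>d\<close>-th root of unity. The
  bound on \<open>n\<close> makes 0 the only admissible multiple of \<open>d\<close>.\<close>

lemma sum_chi:
  assumes d: "d > 0" and n: "\<bar>n\<bar> < int d"
  shows "(\<Sum>h\<in>Zd d. chi d n h) = (if n = 0 then of_nat d else 0)"
proof -
  let ?z = "chi d n 1"
  have "(\<Sum>h\<in>Zd d. chi d n h) = (\<Sum>k<d. chi d n (int k))"
    by (rule sum.reindex_bij_witness[of _ int nat]) (auto simp: Zd_def)
  also have "\<dots> = (\<Sum>k<d. ?z ^ k)"
    by (simp add: chi_cis DeMoivre mult_ac)
  also have "\<dots> = (if n = 0 then of_nat d else 0)"
  proof (cases "n = 0")
    case False
    \<comment> \<open>Ratio 1 would make \<open>n\<close> a multiple of \<open>d\<close>, which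
      \<open>n \<noteq> 0\<close> and \<open>\<bar>n\<bar> < int d\<close> exclude.\<close>
    have "?z \<noteq> 1"
    proof
      assume "?z = 1"
      then obtain m :: int where "2 * pi * of_int n / of_nat d = of_int m * (2 * pi)"
        by (auto simp: chi_cis cis_eq_1_iff)
      then have "of_int n = (of_int (m * int d) :: real)" using d by (simp add: field_simps)
      then have "n = m * int d" by linarith
      then show False using n False by (auto simp: abs_mult)
    qed
    moreover have "?z ^ d = 1"
      using d cis_multiple_2pi[of "of_int n"] by (simp add: chi_cis DeMoivre)
    ultimately show ?thesis using False by (simp add: geometric_sum)
  qed simp
  finally show ?thesis .
qed

text \<open>Two representatives in \<open>Zd d\<close> differ by less than \<open>d\<close> in
  absolute value, so \<open>sum_chi\<close> applies to their difference.\<close>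

lemma chi_orthogonality:
  assumes d: "d > 0" and g: "g \<in> Zd d" "g' \<in> Zd d"
  shows "(\<Sum>h\<in>Zd d. chi d g h * cnj (chi d g' h)) = (if g = g' then of_nat d else 0)"
proof -
  have "(\<Sum>h\<in>Zd d. chi d g h * cnj (chi d g' h)) = (\<Sum>h\<in>Zd d. chi d (g - g') h)"
    by (rule sum.cong) (simp_all add: cnj_chi chi_add_left[symmetric])
  also have "\<dots> = (if g - g' = 0 then of_nat d else 0)"
    using g by (intro sum_chi d) (auto simp: Zd_def)
  finally show ?thesis by simp
qed

section \<open>Adjoints\<close>

text \<open>Operator identities are available only on the domain \<open>l2 d K\<close>. The defining
  property of the adjoint tests nothing else, so they may be used under \<open>adj\<close>.\<close>

lemma adj_cong:
  assumes "\<And>\<psi>. \<psi> \<in> l2 d K \<Longrightarrow> S \<psi> = T \<psi>"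
  shows "adj d K L S = adj d K L T"
  unfolding adj_def using assms by (auto intro!: ext arg_cong[where f = The])

lemma adj_operator:
  assumes "T \<in> operators d K L" and "finite K"
  shows "adj d K L T \<in> operators d L K"
  unfolding operators_def
  by (auto simp: adj_eq[OF assms] l2_def algebra_simps sum.distrib sum_distrib_left)

lemma comp_operator:
  "S \<in> operators d L M \<Longrightarrow> T \<in> operators d K L \<Longrightarrow> S \<circ> T \<in> operators d K M"
  by (auto simp: operators_def)

lemma inner_l2_cnj: "cnj (inner_l2 d K \<phi> \<psi>) = inner_l2 d K \<psi> \<phi>"
  by (simp add: inner_l2_def mult_ac)

lemma adj_comp:
  assumes T: "T \<in> operators d K L" and S: "S \<in> operators d L M"
    and K: "finite K" and L: "finite L"
  shows "adj d K M (S \<circ> T) \<phi> = adj d K L T (adj d L M S \<phi>)"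
proof (rule adj_eqI[OF K adj_closed[OF T K]])
  fix \<psi> assume \<psi>: "\<psi> \<in> l2 d K"
  show "inner_l2 d K (adj d K L T (adj d L M S \<phi>)) \<psi> = inner_l2 d M \<phi> ((S \<circ> T) \<psi>)"
    by (simp add: adj_inner[OF T K \<psi>] adj_inner[OF S L operators_closed[OF T \<psi>]])
qed

text \<open>By conjugate symmetry of the inner product, \<open>T \<psi>\<close> has the property
  that characterises the second adjoint.\<close>

lemma adj_adj:
  assumes T: "T \<in> operators d K L" and K: "finite K" and L: "finite L" and \<psi>: "\<psi> \<in> l2 d K"
  shows "adj d L K (adj d K L T) \<psi> = T \<psi>"
proof (rule adj_eqI[OF L operators_closed[OF T \<psi>]])
  fix \<phi> assume "\<phi> \<in> l2 d L"
  show "inner_l2 d L (T \<psi>) \<phi> = inner_l2 d K \<psi> (adj d K L T \<phi>)"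
    using adj_inner[OF T K \<psi>, of \<phi>] by (metis inner_l2_cnj)
qed

lemma adj_op_scale:
  assumes T: "T \<in> operators d K L" and K: "finite K"
  shows "adj d K L (op_scale c T) \<phi> = (\<lambda>g. cnj c * adj d K L T \<phi> g)"
proof (rule adj_eqI[OF K])
  show "(\<lambda>g. cnj c * adj d K L T \<phi> g) \<in> l2 d K"
    using adj_closed[OF T K, of \<phi>] by (simp add: l2_def)
next
  fix \<psi> assume \<psi>: "\<psi> \<in> l2 d K"
  have "inner_l2 d K (\<lambda>g. cnj c * adj d K L T \<phi> g) \<psi> = c * inner_l2 d K (adj d K L T \<phi>) \<psi>"
    by (simp add: inner_l2_def sum_distrib_left mult_ac)
  also have "\<dots> = inner_l2 d L \<phi> (op_scale c T \<psi>)"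
    unfolding adj_inner[OF T K \<psi>] by (simp add: inner_l2_def op_scale_def sum_distrib_left mult_ac)
  finally show "inner_l2 d K (\<lambda>g. cnj c * adj d K L T \<phi> g) \<psi> = inner_l2 d L \<phi> (op_scale c T \<psi>)" .
qed

lemma operators_zero: "T \<in> operators d K L \<Longrightarrow> T (\<lambda>g. 0) = (\<lambda>g. 0)"
  using operators_scale[of T d K L "\<lambda>g. 0" 0] by (simp add: l2_def)

lemma l2_sum: "(\<And>i. i \<in> A \<Longrightarrow> f i \<in> l2 d K) \<Longrightarrow> (\<lambda>g. \<Sum>i\<in>A. f i g) \<in> l2 d K"
  by (auto simp: l2_def intro!: sum.neutral)

lemma operators_sum:
  assumes T: "T \<in> operators d K L" and A: "finite A" and f: "\<And>i. i \<in> A \<Longrightarrow> f i \<in> l2 d K"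
  shows "T (\<lambda>g. \<Sum>i\<in>A. f i g) = (\<lambda>g. \<Sum>i\<in>A. T (f i) g)"
  using A f
proof (induction A rule: finite_induct)
  case empty then show ?case by (simp add: operators_zero[OF T])
next
  case (insert i A)
  have "T (\<lambda>g. f i g + (\<Sum>i\<in>A. f i g)) = (\<lambda>g. T (f i) g + T (\<lambda>g. \<Sum>i\<in>A. f i g) g)"
    using insert.prems by (intro operators_add[OF T] l2_sum) auto
  then show ?case using insert by simp
qed

lemma lin_ket:
  assumes "finite K" and "g \<in> cfg d K"
  shows "lin d K b (ket g) = b g"
proof
  fix k
  have "lin d K b (ket g) k = (\<Sum>h\<in>cfg d K. if h = g then b g k else 0)"
    unfolding lin_def by (rule sum.cong) (auto simp: ket_def)
  then show "lin d K b (ket g) k = b g k" using assms by (simp add: finite_cfg)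
qed

section \<open>Fourier transforms\<close>

lemma cfg_update: "g \<in> cfg d V \<Longrightarrow> i \<in> V \<Longrightarrow> h \<in> Zd d \<Longrightarrow> g(i := h) \<in> cfg d V"
  by (auto simp: cfg_def PiE_def extensional_def)

lemma cfg_Zd: "g \<in> cfg d V \<Longrightarrow> i \<in> V \<Longrightarrow> g i \<in> Zd d"
  by (auto simp: cfg_def)

lemma fourier_operator:
  assumes "i \<in> V" shows "fourier d V i \<in> operators d V V"
  unfolding fourier_def
  by (rule lin_operator) (auto simp: l2_def ket_def cfg_update[OF _ assms] intro!: sum.neutral)

text \<open>Turns the description by images of basis vectors into an integral kernel: only
  configurations agreeing with \<open>k\<close> off \<open>i\<close> contribute to the component at
  \<open>k\<close>. The formula holds for every function \<open>\<psi>\<close>, also outside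
  \<open>l2\<close>.\<close>

lemma fourier_apply:
  assumes V: "finite V" and i: "i \<in> V"
  shows "fourier d V i \<psi> k = (if k \<in> cfg d V
    then complex_of_real (1 / sqrt (real d)) * (\<Sum>h\<in>Zd d. chi d h (k i) * \<psi> (k(i := h))) else 0)"
proof (cases "k \<in> cfg d V")
  case True
  let ?c = "complex_of_real (1 / sqrt (real d))"
  have in1: "(\<Sum>h\<in>Zd d. chi d (g i) h * ket (g(i := h)) k)
      = (if g(i := k i) = k then chi d (g i) (k i) else 0)" for g
  proof -
    have "(\<Sum>h\<in>Zd d. chi d (g i) h * ket (g(i := h)) k)
      = (\<Sum>h\<in>Zd d. if h = k i then (if g(i := k i) = k then chi d (g i) (k i) else 0) else 0)"
      by (rule sum.cong) (auto simp: ket_def fun_eq_iff)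
    then show ?thesis using cfg_Zd[OF True i] by simp
  qed
  have upd: "k(i := g i) = g" if "g(i := k i) = k" for g
    using that by (metis fun_upd_triv fun_upd_upd)
  have "fourier d V i \<psi> k
      = (\<Sum>g\<in>cfg d V. if g(i := k i) = k then ?c * (chi d (g i) (k i) * \<psi> g) else 0)"
    unfolding fourier_def lin_def in1 by (rule sum.cong) auto
  also have "\<dots> = (\<Sum>g\<in>{g\<in>cfg d V. g(i := k i) = k}. ?c * (chi d (g i) (k i) * \<psi> g))"
    by (rule sum.inter_filter[symmetric]) (rule finite_cfg[OF V])
  \<comment> \<open>The contributing configurations are the updates of \<open>k\<close> at
    \<open>i\<close>, parametrised by their entry there.\<close>
  also have "\<dots> = (\<Sum>h\<in>Zd d. ?c * (chi d h (k i) * \<psi> (k(i := h))))"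
    by (rule sum.reindex_bij_witness[of _ "\<lambda>h. k(i := h)" "\<lambda>g. g i"])
      (use True i in \<open>auto simp: upd cfg_Zd cfg_update\<close>)
  finally show ?thesis using True by (simp add: sum_distrib_left)
next
  case False
  then show ?thesis
    using i by (auto simp: fourier_def lin_def ket_def cfg_update intro!: sum.neutral)
qed

text \<open>The adjoint pairs with the conjugated image of \<open>ket g\<close>, and that image is
  supported on the updates of \<open>g\<close> at \<open>i\<close>.\<close>

lemma fourier_adj_apply:
  assumes V: "finite V" and i: "i \<in> V"
  shows "adj d V V (fourier d V i) \<phi> g = (if g \<in> cfg d V
    then complex_of_real (1 / sqrt (real d)) * (\<Sum>h\<in>Zd d. cnj (chi d (g i) h)
      * \<phi> (g(i := h))) else 0)"
proof (cases "g \<in> cfg d V")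
  case True
  let ?c = "complex_of_real (1 / sqrt (real d))"
  have "adj d V V (fourier d V i) \<phi> g = (\<Sum>k\<in>cfg d V. cnj (fourier d V i (ket g) k) * \<phi> k)"
    using True by (simp add: adj_eq[OF fourier_operator[OF i] V])
  also have "\<dots> = (\<Sum>k\<in>cfg d V. \<Sum>h\<in>Zd d. ?c * cnj (chi d (g i) h) * ket (g(i := h)) k * \<phi> k)"
    unfolding fourier_def lin_ket[OF V True]
    by (rule sum.cong) (auto simp: ket_def sum_distrib_left sum_distrib_right intro!: sum.cong)
  also have "\<dots> = (\<Sum>h\<in>Zd d. \<Sum>k\<in>cfg d V. ?c * cnj (chi d (g i) h) * ket (g(i := h)) k * \<phi> k)"
    by (rule sum.swap)
  also have "\<dots> = (\<Sum>h\<in>Zd d. ?c * (cnj (chi d (g i) h) * \<phi> (g(i := h))))"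
  proof (rule sum.cong[OF refl])
    fix h assume h: "h \<in> Zd d"
    have "(\<Sum>k\<in>cfg d V. ?c * cnj (chi d (g i) h) * ket (g(i := h)) k * \<phi> k)
      = (\<Sum>k\<in>cfg d V. if k = g(i := h) then ?c * (cnj (chi d (g i) h) * \<phi> (g(i := h))) else 0)"
      by (rule sum.cong) (auto simp: ket_def)
    then show "(\<Sum>k\<in>cfg d V. ?c * cnj (chi d (g i) h) * ket (g(i := h)) k * \<phi> k)
      = ?c * (cnj (chi d (g i) h) * \<phi> (g(i := h)))"
      using cfg_update[OF True i h] finite_cfg[OF V] by simp
  qed
  finally show ?thesis using True by (simp add: sum_distrib_left)
next
  case False
  then show ?thesis by (simp add: adj_eq[OF fourier_operator[OF i] V])
qed

lemma of_real_inverse_sqrt_squared: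
  "complex_of_real (1 / sqrt (real d)) * complex_of_real (1 / sqrt (real d)) = 1 / of_nat d"
  unfolding of_real_mult[symmetric] by simp

text \<open>Only this order of the two factors is established; it is the order in which the
  transforms over \<open>X\<close> inside the cluster operator meet the adjoint of
  \<open>F\<^sub>X\<close>.\<close>

lemma fourier_unitary:
  assumes d: "d > 0" and V: "finite V" and i: "i \<in> V" and \<phi>: "\<phi> \<in> l2 d V"
  shows "fourier d V i (adj d V V (fourier d V i) \<phi>) = \<phi>"
proof
  fix k
  let ?c = "complex_of_real (1 / sqrt (real d))"
  show "fourier d V i (adj d V V (fourier d V i) \<phi>) k = \<phi> k"
  proof (cases "k \<in> cfg d V")
    case True
    have "fourier d V i (adj d V V (fourier d V i) \<phi>) k
      = ?c * (\<Sum>h\<in>Zd d. chi d h (k i) * (?c * (\<Sum>h'\<in>Zd d. cnj (chi d h h') * \<phi> (k(i := h')))))"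
      using True
        by (simp add: fourier_apply[OF V i] fourier_adj_apply[OF V i] cfg_update[OF True i])
    also have "\<dots> = ?c * ?c * (\<Sum>h\<in>Zd d. \<Sum>h'\<in>Zd d. chi d h (k i) * cnj (chi d h h') * \<phi> (k(i := h')))"
      by (simp add: sum_distrib_left mult_ac)
    \<comment> \<open>With the sums exchanged, the sum over the intermediate index is character
      orthogonality, and its factor \<open>d\<close> cancels the two factors
      \<open>1 / sqrt d\<close>.\<close>
    also have "\<dots> = ?c * ?c * (\<Sum>h'\<in>Zd d. (\<Sum>h\<in>Zd d. chi d (k i) h * cnj (chi d h' h))
      * \<phi> (k(i := h')))"
      by (subst sum.swap) (simp add: sum_distrib_right chi_commute[of d "k i"] chi_commute[of _ _
        _])
    also have "\<dots> = ?c * ?c * (\<Sum>h'\<in>Zd d. if h' = k i then of_nat d * \<phi> k else 0)"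
      by (intro arg_cong2[where f = "(*)"] sum.cong refl)
        (auto simp: chi_orthogonality[OF d cfg_Zd[OF True i]])
    also have "\<dots> = \<phi> k"
      using cfg_Zd[OF True i] d unfolding of_real_inverse_sqrt_squared by simp
    finally show ?thesis .
  next
    case False
    then show ?thesis using \<phi> by (simp add: fourier_apply[OF V i] l2_def)
  qed
qed

text \<open>Both orders give the same double sum over the entries at \<open>i\<close> and
  \<open>j\<close>, since updates at different vertices commute. This justifies products over sets
  of vertices.\<close>

lemma fourier_commute:
  assumes V: "finite V" and i: "i \<in> V" and j: "j \<in> V"
  shows "fourier d V i \<circ> fourier d V j = fourier d V j \<circ> fourier d V i"
proof (cases "i = j")
  case False
  show ?thesis
  proof (intro ext)
    fix \<psi> k
    let ?c = "complex_of_real (1 / sqrt (real d))"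
    have *: "(fourier d V i \<circ> fourier d V j) \<psi> k = ?c * ?c * (\<Sum>h\<in>Zd d. \<Sum>h'\<in>Zd d.
        chi d h (k i) * (chi d h' (k j) * \<psi> (k(i := h, j := h'))))"
      if "k \<in> cfg d V" "i \<in> V" "j \<in> V" "i \<noteq> j" for i j
      using that by (simp add: fourier_apply[OF V] cfg_update sum_distrib_left mult_ac)
    show "(fourier d V i \<circ> fourier d V j) \<psi> k = (fourier d V j \<circ> fourier d V i) \<psi> k"
    proof (cases "k \<in> cfg d V")
      case True
      show ?thesis
        unfolding *[OF True i j False] *[OF True j i False[symmetric]]
        by (subst sum.swap) (use False in \<open>simp add: fun_upd_twist[of i j] mult_ac\<close>)
    next
      case False
      then show ?thesis by (simp add: fourier_apply[OF V i] fourier_apply[OF V j])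
    qed
  qed
qed simp

section \<open>Products of commuting operators and Fourier transforms over sets of vertices\<close>

lemma op_prod_empty [simp]: "op_prod T {} = id"
  by (simp add: op_prod_def)

text \<open>\<open>op_prod\<close> is a \<open>Finite_Set.fold\<close>, which unfolds along an
  insertion when left composition with the factors commutes. Commutation is asked for on the index
  set only, because \<open>fourier_commute\<close> supplies it just for vertices of
  \<open>V\<close>.\<close>

lemma op_prod_insert:
  assumes "\<And>i j. i \<in> insert x A \<Longrightarrow> j \<in> insert x A \<Longrightarrow> T i \<circ> T j = T j \<circ> T i"
    and "finite A" and "x \<notin> A"
  shows "op_prod T (insert x A) = T x \<circ> op_prod T A"
proof -
  interpret comp_fun_commute_on "insert x A" "\<lambda>i S. T i \<circ> S"
    by standard (use assms(1) in \<open>auto simp: fun_eq_iff\<close>)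
  show ?thesis
    unfolding op_prod_def by (rule fold_insert) (use assms in auto)
qed

lemma fourier_set_insert:
  assumes V: "finite V" and K: "insert i K \<subseteq> V" and i: "i \<notin> K"
  shows "fourier_set d V (insert i K) = fourier d V i \<circ> fourier_set d V K"
proof -
  have "finite K" using V K by (meson finite_subset insert_subset)
  then show ?thesis unfolding fourier_set_def
    using K i by (intro op_prod_insert fourier_commute[OF V]) auto
qed

lemma fourier_set_operator:
  assumes V: "finite V" and K: "K \<subseteq> V"
  shows "fourier_set d V K \<in> operators d V V"
proof -
  have "finite K" using V K by (rule rev_finite_subset)
  then show ?thesis using K
  proof (induction K rule: finite_induct)
    case empty then show ?case by (simp add: fourier_set_def operators_def)
  next
    case (insert i K)
    then have "fourier d V i \<circ> fourier_set d V K \<in> operators d V V"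
      by (intro comp_operator[OF fourier_operator]) auto
    then show ?case by (simp only: fourier_set_insert[OF V insert.prems insert.hyps(2)])
  qed
qed

text \<open>Used with \<open>K = V - X\<close> and \<open>L = X\<close>, so that the transforms over
  \<open>X\<close> act first and stand next to the adjoint they cancel.\<close>

lemma fourier_set_union:
  assumes V: "finite V" and KL: "K \<union> L \<subseteq> V" and disj: "K \<inter> L = {}"
  shows "fourier_set d V (K \<union> L) = fourier_set d V K \<circ> fourier_set d V L"
proof -
  have "finite K" using V KL by (meson finite_subset le_supE)
  then show ?thesis using KL disj
  proof (induction K rule: finite_induct)
    case empty then show ?case by (simp add: fourier_set_def)
  next
    case (insert i K)
    have "fourier_set d V (insert i (K \<union> L)) = fourier d V i \<circ> fourier_set d V (K \<union> L)"
      by (rule fourier_set_insert[OF V]) (use insert in auto)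
    moreover have "fourier_set d V (insert i K) = fourier d V i \<circ> fourier_set d V K"
      by (rule fourier_set_insert[OF V]) (use insert in auto)
    ultimately show ?case using insert by (simp add: o_assoc)
  qed
qed

text \<open>Taking adjoints reverses the order of the factors, so the product cancels from the
  inside out. The vector is generalised because the induction hypothesis is applied to the adjoint
  of \<open>fourier d V i\<close> at \<open>\<phi>\<close>.\<close>

lemma fourier_set_unitary:
  assumes d: "d > 0" and V: "finite V" and K: "K \<subseteq> V" and \<phi>: "\<phi> \<in> l2 d V"
  shows "fourier_set d V K (adj d V V (fourier_set d V K) \<phi>) = \<phi>"
proof -
  have "finite K" using V K by (rule rev_finite_subset)
  then show ?thesis using K \<phi>
  proof (induction K arbitrary: \<phi> rule: finite_induct)
    case empty
    have "adj d V V id \<phi> = \<phi>" by (rule adj_eqI[OF V empty.prems(2)]) simp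
    then show ?case by (simp add: fourier_set_def id_def)
  next
    case (insert i K)
    have i: "i \<in> V" and KV: "K \<subseteq> V" using insert by auto
    note F = fourier_operator[OF i, of d]
    have "adj d V V (fourier_set d V (insert i K)) \<phi>
        = adj d V V (fourier_set d V K) (adj d V V (fourier d V i) \<phi>)"
      unfolding fourier_set_insert[OF V insert.prems(1) insert.hyps(2)]
      by (rule adj_comp[OF fourier_set_operator[OF V KV] F V V])
    then have "fourier_set d V (insert i K) (adj d V V (fourier_set d V (insert i K)) \<phi>)
      = fourier d V i (fourier_set d V K (adj d V V (fourier_set d V K) (adj d V V (fourier d V i)
        \<phi>)))"
      using fourier_set_insert[OF V insert.prems(1) insert.hyps(2)] by (metis comp_apply)
    then show ?case
      by (simp only: insert.IH[OF KV adj_closed[OF F V]] fourier_unitary[OF d V i insert.prems(2)])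
  qed
qed

text \<open>Kernels of transforms at different vertices multiply to the character of the power of
  the group. The induction generalises \<open>k\<close>, as each new transform evaluates the
  previous ones at \<open>k(i := x)\<close>.\<close>

lemma fourier_set_apply:
  assumes d: "d > 0" and V: "finite V" and K: "K \<subseteq> V" and \<psi>: "\<psi> \<in> l2 d V" and k: "k \<in> cfg d V"
  shows "fourier_set d V K \<psi> k = complex_of_real (1 / sqrt (real d)) ^ card K *
    (\<Sum>h\<in>cfg d K. chi_on d K h k * \<psi> (override_on k h K))"
proof -
  have "finite K" using V K by (rule rev_finite_subset)
  then show ?thesis using K k
  proof (induction K arbitrary: k rule: finite_induct)
    case empty
    then show ?case by (simp add: fourier_set_def cfg_def chi_on_def)
  next
    case (insert i K)
    let ?c = "complex_of_real (1 / sqrt (real d))"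
    have i: "i \<in> V" and KV: "K \<subseteq> V" using insert by auto
    have ov: "override_on (k(i := x)) h K = override_on k (h(i := x)) (insert i K)" for x h
      using insert.hyps by (auto simp: override_on_def)
    have ch: "chi_on d K h (k(i := x)) = chi_on d K h k"
      "chi_on d (insert i K) (h(i := x)) k = chi d x (k i) * chi_on d K h k" for x h
      using insert.hyps by (auto simp: chi_on_def intro!: prod.cong)
    have "fourier_set d V (insert i K) \<psi> k
      = ?c * (\<Sum>x\<in>Zd d. chi d x (k i) * fourier_set d V K \<psi> (k(i := x)))"
      using insert.prems
      by (simp add: fourier_set_insert[OF V insert.prems(1) insert.hyps(2)] fourier_apply[OF V i])
    also have "\<dots> = ?c * (\<Sum>x\<in>Zd d. chi d x (k i) * (?c ^ card K *
        (\<Sum>h\<in>cfg d K. chi_on d K h k * \<psi> (override_on k (h(i := x)) (insert i K)))))"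
      by (intro arg_cong2[where f = "(*)"] sum.cong refl)
        (simp only: insert.IH[OF KV cfg_update[OF insert.prems(2) i]] ov ch)
    also have "\<dots> = ?c ^ card (insert i K) * (\<Sum>x\<in>Zd d. \<Sum>h\<in>cfg d K.
        chi_on d (insert i K) (h(i := x)) k * \<psi> (override_on k (h(i := x)) (insert i K)))"
      using insert.hyps by (simp add: ch sum_distrib_left mult_ac)
    \<comment> \<open>A configuration on \<open>insert i K\<close> is an entry at \<open>i\<close>
      together with a configuration on \<open>K\<close>.\<close>
    also have "(\<Sum>x\<in>Zd d. \<Sum>h\<in>cfg d K.
        chi_on d (insert i K) (h(i := x)) k * \<psi> (override_on k (h(i := x)) (insert i K)))
      = (\<Sum>h\<in>cfg d (insert i K). chi_on d (insert i K) h k * \<psi> (override_on k h (insert i K)))"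
      unfolding cfg_def PiE_insert_eq
      by (subst sum.reindex[OF inj_combinator[OF insert.hyps(2)]])
        (simp add: sum.cartesian_product case_prod_unfold)
    finally show ?case .
  qed
qed


section \<open>Phase gates and the cluster operator\<close>

text \<open>The gate permutes the basis, so the component at \<open>k\<close> is that of
  \<open>\<psi>\<close> at the preimage of \<open>k\<close>. As \<open>i \<noteq> j\<close>, the
  control entry is unchanged and subtraction undoes the shift.\<close>

lemma ctrl_shift_apply:
  assumes d: "d > 0" and V: "finite V" and j: "j \<in> V" and ij: "i \<noteq> j" and k: "k \<in> cfg d V"
  shows "ctrl_shift d V i j n \<psi> k = \<psi> (k(j := (k j - n * k i) mod int d))"
proof -
  have m: "x mod int d = x" if "x \<in> Zd d" for x using that by (simp add: Zd_def)
  let ?g = "k(j := (k j - n * k i) mod int d)"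
  have "k = g(j := (g j + n * g i) mod int d) \<longleftrightarrow> g = ?g" if g: "g \<in> cfg d V" for g
  proof
    assume eq: "k = g(j := (g j + n * g i) mod int d)"
    show "g = ?g"
      by (subst (1 2 3) eq) (use ij m[OF cfg_Zd[OF g j]] in \<open>simp add: mod_diff_left_eq\<close>)
  next
    assume eq: "g = ?g"
    show "k = g(j := (g j + n * g i) mod int d)"
      by (subst (1 2 3) eq) (use ij m[OF cfg_Zd[OF k j]] in \<open>simp add: mod_add_left_eq\<close>)
  qed
  then have "ctrl_shift d V i j n \<psi> k = (\<Sum>g\<in>cfg d V. if g = ?g then \<psi> ?g else 0)"
    unfolding ctrl_shift_def lin_def by (intro sum.cong) (auto simp: ket_def)
  then show ?thesis using k by (simp add: finite_cfg[OF V] cfg_update[OF k j] mod_in_Zd d)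
qed

text \<open>The Fourier transform at \<open>j\<close> diagonalises translations of the
  \<open>j\<close>-th entry: conjugating the shift by \<open>n * k i\<close> yields multiplication
  by a character value.\<close>

lemma ctrl_phase_apply:
  assumes d: "d > 0" and V: "finite V" and j: "j \<in> V" and ij: "i \<noteq> j"
  shows "ctrl_phase d V i j n \<psi> k
    = (if k \<in> cfg d V then chi d (k i) (k j) powi n * \<psi> k else 0)"
proof (cases "k \<in> cfg d V")
  case True
  let ?c = "complex_of_real (1 / sqrt (real d))"
  let ?\<phi> = "adj d V V (fourier d V j) \<psi>"
  \<comment> \<open>The adjoint transform makes the translation of its argument a factor
    \<open>chi d (n * k i) h'\<close> that does not depend on \<open>h\<close>.\<close>
  have shifted: "ctrl_shift d V i j n ?\<phi> (k(j := h))
      = ?c * (\<Sum>h'\<in>Zd d. cnj (chi d h h') * (chi d (n * k i) h' * \<psi> (k(j := h'))))"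
    if h: "h \<in> Zd d" for h
  proof -
    have "cnj (chi d ((h - n * k i) mod int d) h') = cnj (chi d h h') * chi d (n * k i) h'" for h'
      by (simp add: chi_mod_left[OF d] cnj_chi flip: chi_add_left)
    then show ?thesis
      using ij by (simp add: ctrl_shift_apply[OF d V j ij cfg_update[OF True j h]]
          fourier_adj_apply[OF V j] cfg_update[OF True j] mod_in_Zd[OF d] mult.assoc)
  qed
  have "ctrl_phase d V i j n \<psi> k = ?c * (\<Sum>h\<in>Zd d. chi d h (k j) *
      (?c * (\<Sum>h'\<in>Zd d. cnj (chi d h h') * (chi d (n * k i) h' * \<psi> (k(j := h'))))))"
    using True by (simp add: ctrl_phase_def fourier_apply[OF V j] shifted)
  also have "\<dots> = ?c * ?c * (\<Sum>h\<in>Zd d. \<Sum>h'\<in>Zd d.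
      chi d h (k j) * cnj (chi d h h') * (chi d (n * k i) h' * \<psi> (k(j := h'))))"
    by (simp add: sum_distrib_left mult_ac)
  \<comment> \<open>Exchanging the sums exposes orthogonality, which leaves only
    \<open>h' = k j\<close>.\<close>
  also have "\<dots> = ?c * ?c * (\<Sum>h'\<in>Zd d. (\<Sum>h\<in>Zd d. chi d (k j) h * cnj (chi d h' h)) *
      (chi d (n * k i) h' * \<psi> (k(j := h'))))"
    by (subst sum.swap) (simp add: sum_distrib_right chi_commute[of d "k j"] chi_commute[of _ _ _])
  also have "\<dots> = ?c * ?c * (\<Sum>h'\<in>Zd d.
      if h' = k j then of_nat d * (chi d (n * k i) (k j) * \<psi> k) else 0)"
    by (intro arg_cong2[where f = "(*)"] sum.cong refl)
      (auto simp: chi_orthogonality[OF d cfg_Zd[OF True j]])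
  also have "\<dots> = chi d (n * k i) (k j) * \<psi> k"
    using cfg_Zd[OF True j] d unfolding of_real_inverse_sqrt_squared by simp
  finally show ?thesis using True by (simp add: chi_mult_left)
next
  case False
  then show ?thesis by (simp add: ctrl_phase_def fourier_apply[OF V j])
qed

text \<open>The pair has just two orderings, and symmetry gives them one value, so the definite
  description is determined.\<close>

lemma on_pair_eq:
  assumes "i \<noteq> j" and "f i j = f j i" shows "on_pair f {i, j} = f i j"
  unfolding on_pair_def
proof (rule the_equality)
  show "\<exists>i' j'. i' \<noteq> j' \<and> {i, j} = {i', j'} \<and> f i j = f i' j'" using assms(1) by blast
qed (use assms in \<open>auto simp: doubleton_eq_iff\<close>)

text \<open>The wave function without its normalisation, for an arbitrary set of edges so that
  induction can add one edge at a time.\<close>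

definition phase :: "nat \<Rightarrow> ('v \<Rightarrow> 'v \<Rightarrow> int) \<Rightarrow> 'v set set \<Rightarrow> ('v \<Rightarrow> int) \<Rightarrow> complex" where
  "phase d \<Gamma> E g = (\<Prod>e\<in>E. on_pair (\<lambda>i j. chi d (g i) (g j) powi \<Gamma> i j) e)"

text \<open>Both orientations of an edge give the same diagonal gate, by symmetry of the weights and
  of \<open>chi\<close>; hence the gate is well defined on unordered pairs.\<close>

lemma on_pair_ctrl_phase_apply:
  assumes d: "d > 0" and \<Gamma>: "weighted_graph V \<Gamma>" and e: "e \<in> pairs V"
  shows "on_pair (\<lambda>i j. ctrl_phase d V i j (\<Gamma> i j)) e \<psi> k
    = (if k \<in> cfg d V then on_pair (\<lambda>i j. chi d (k i) (k j) powi \<Gamma> i j) e * \<psi> k else 0)"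
proof -
  obtain i j where ij: "i \<noteq> j" "e = {i, j}" "i \<in> V" "j \<in> V"
    using e by (auto simp: pairs_def card_2_iff)
  have V: "finite V" and sym: "\<Gamma> j i = \<Gamma> i j" using \<Gamma> ij by (auto simp: weighted_graph_def)
  have "ctrl_phase d V i j (\<Gamma> i j) = ctrl_phase d V j i (\<Gamma> j i)"
    using ij by (intro ext) (simp add: ctrl_phase_apply[OF d V] sym chi_commute)
  then have "on_pair (\<lambda>i j. ctrl_phase d V i j (\<Gamma> i j)) e = ctrl_phase d V i j (\<Gamma> i j)"
    unfolding ij(2) by (rule on_pair_eq[OF ij(1)])
  moreover have "on_pair (\<lambda>i j. chi d (k i) (k j) powi \<Gamma> i j) e = chi d (k i) (k j) powi \<Gamma> i j"
    unfolding ij(2) by (rule on_pair_eq[OF ij(1)]) (simp add: sym chi_commute)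
  ultimately show ?thesis using ij by (simp add: ctrl_phase_apply[OF d V])
qed

lemma finite_pairs: "finite V \<Longrightarrow> finite (pairs V)"
  by (simp add: pairs_def)

text \<open>Diagonal gates commute and their eigenvalues multiply. Membership of
  \<open>\<psi>\<close> in \<open>l2\<close> absorbs the cut-off each gate makes outside the
  configurations.\<close>

lemma op_prod_ctrl_phase_apply:
  assumes d: "d > 0" and \<Gamma>: "weighted_graph V \<Gamma>" and E: "E \<subseteq> pairs V" and \<psi>: "\<psi> \<in> l2 d V"
  shows "op_prod (on_pair (\<lambda>i j. ctrl_phase d V i j (\<Gamma> i j))) E \<psi> = (\<lambda>k. phase d \<Gamma> E k * \<psi> k)"
proof -
  have "finite V" using \<Gamma> by (simp add: weighted_graph_def)
  then have "finite E" using E finite_pairs by (metis finite_subset)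
  then show ?thesis using E
  proof (induction E rule: finite_induct)
    case empty then show ?case by (simp add: phase_def)
  next
    case (insert e E)
    note ap = on_pair_ctrl_phase_apply[OF d \<Gamma> subsetD[OF insert.prems]]
    have "op_prod (on_pair (\<lambda>i j. ctrl_phase d V i j (\<Gamma> i j))) (insert e E)
      = on_pair (\<lambda>i j. ctrl_phase d V i j (\<Gamma> i j)) e \<circ>
        op_prod (on_pair (\<lambda>i j. ctrl_phase d V i j (\<Gamma> i j))) E"
      by (rule op_prod_insert[OF _ insert.hyps]) (intro ext, simp add: ap)
    then show ?case using insert \<psi> by (auto simp: ap phase_def l2_def fun_eq_iff)
  qed
qed

lemma cluster_op_apply:
  assumes d: "d > 0" and \<Gamma>: "weighted_graph V \<Gamma>" and \<psi>: "\<psi> \<in> l2 d V"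
  shows "cluster_op d V \<Gamma> \<psi> = (\<lambda>k. phase d \<Gamma> (pairs V) k * fourier_set d V V \<psi> k)"
proof -
  have "finite V" using \<Gamma> by (simp add: weighted_graph_def)
  then show ?thesis unfolding cluster_op_def
    by (simp add: op_prod_ctrl_phase_apply[OF d \<Gamma>] operators_closed[OF fourier_set_operator] \<psi>)
qed

lemma cluster_op_operator:
  assumes d: "d > 0" and \<Gamma>: "weighted_graph V \<Gamma>"
  shows "cluster_op d V \<Gamma> \<in> operators d V V"
proof -
  have V: "finite V" using \<Gamma> by (simp add: weighted_graph_def)
  have "op_prod (on_pair (\<lambda>i j. ctrl_phase d V i j (\<Gamma> i j))) (pairs V) \<in> operators d V V"
    unfolding operators_def
    by (auto simp: op_prod_ctrl_phase_apply[OF d \<Gamma>]) (auto simp: l2_def algebra_simps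
      op_prod_ctrl_phase_apply[OF d \<Gamma>])
  then show ?thesis unfolding cluster_op_def
    by (intro comp_operator[OF _ fourier_set_operator[OF V]]) auto
qed

lemma wave_function_phase:
  "wave_function d V \<Gamma> g = complex_of_real (real d powr (- (1/2) * real (card V)))
    * phase d \<Gamma> (pairs V) g"
  by (simp add: wave_function_def phase_def)

section \<open>Embeddings, shifts and multipliers\<close>

lemma override_cfg: "k \<in> cfg d V \<Longrightarrow> K \<subseteq> V \<Longrightarrow> h \<in> cfg d K \<Longrightarrow> override_on k h K \<in> cfg d V"
  by (auto simp: cfg_def PiE_def extensional_def override_on_def Pi_def)

lemma override_cfg_Diff:
  "g \<in> cfg d (V - K) \<Longrightarrow> K \<subseteq> V \<Longrightarrow> h \<in> cfg d K \<Longrightarrow> override_on g h K \<in> cfg d V"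
  by (auto simp: cfg_def PiE_def extensional_def override_on_def Pi_def)

lemma restrict_override:
  assumes "h \<in> cfg d K" shows "restrict (override_on k h K) K = h"
  using assms
    by (auto simp: cfg_def override_on_def restrict_def PiE_def extensional_def fun_eq_iff)

lemma zero_cfg: "d > 0 \<Longrightarrow> (\<lambda>i\<in>K. 0) \<in> cfg d K"
  by (auto simp: cfg_def Zd_def)

text \<open>The embedding sends \<open>ket g\<close> to the single basis vector that extends
  \<open>g\<close> by zeros on \<open>K\<close>, so its adjoint reads off the component
  there.\<close>

lemma embed_adj_apply:
  assumes d: "d > 0" and V: "finite V" and K: "K \<subseteq> V"
  shows "embed_adj d V K \<phi> g
    = (if g \<in> cfg d (V - K) then \<phi> (override_on g (\<lambda>i\<in>K. 0) K) else 0)"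
proof (cases "g \<in> cfg d (V - K)")
  case True
  let ?k = "override_on g (\<lambda>i\<in>K. 0) K"
  have KV: "K \<union> (V - K) = V" using K by blast
  have k: "?k \<in> cfg d V" by (rule override_cfg_Diff[OF True K zero_cfg[OF d]])
  have iff: "restrict k K = (\<lambda>i\<in>K. 0) \<and> restrict k (V - K) = g \<longleftrightarrow> k = ?k" if "k \<in> cfg d V" for k
  proof
    assume a: "restrict k K = (\<lambda>i\<in>K. 0) \<and> restrict k (V - K) = g"
    have "k i = ?k i" for i
    proof (cases "i \<in> K")
      case True then show ?thesis using a by (metis override_on_apply_in restrict_apply')
    next
      case False
      have "k i = g i"
      proof (cases "i \<in> V")
        case True
        have "restrict k (V - K) i = g i" using a by simp
        then show ?thesis using True False by simp
      next
        case False
        \<comment> \<open>Outside \<open>V\<close> both configurations are extensional and take the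
          value \<open>undefined\<close>.\<close>
        then show ?thesis using that True by (auto simp: cfg_def PiE_def extensional_def)
      qed
      then show ?thesis using False by simp
    qed
    then show "k = ?k" ..
  next
    assume k: "k = ?k"
    show "restrict k K = (\<lambda>i\<in>K. 0) \<and> restrict k (V - K) = g"
      unfolding k using restrict_override[OF zero_cfg[OF d]] True
      by (auto simp: cfg_def PiE_def extensional_def override_on_def restrict_def fun_eq_iff)
  qed
  have "embed_adj d V K \<phi> g = (\<Sum>k\<in>cfg d V. cnj (embed d V K (ket g) k) * \<phi> k)"
    using True V by (simp add: embed_adj_def adj_eq[OF embed_operator[OF K]])
  also have "\<dots> = (\<Sum>k\<in>cfg d V. if k = ?k then \<phi> ?k else 0)"
  proof (rule sum.cong[OF refl])
    fix k assume k: "k \<in> cfg d V"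
    have "embed d V K (ket g) k = (if k = ?k then 1 else 0)"
      unfolding embed_def tensor_vec_def KV iff[OF k, symmetric] by (simp add: k ket_def)
    then show "cnj (embed d V K (ket g) k) * \<phi> k = (if k = ?k then \<phi> ?k else 0)" by simp
  qed
  also have "\<dots> = \<phi> ?k" using k finite_cfg[OF V] by simp
  finally show ?thesis using True by simp
next
  case False
  then show ?thesis using V by (simp add: embed_adj_def adj_eq[OF embed_operator[OF K]])
qed

lemma cfg_add_closed: "d > 0 \<Longrightarrow> cfg_add d V g h \<in> cfg d V"
  by (auto simp: cfg_add_def cfg_def Zd_def)

lemma shift_adj_apply:
  assumes d: "d > 0" and V: "finite V" and g: "g \<in> cfg d V"
  shows "adj d V V (shift d V X h) \<phi> g = \<phi> (cfg_add d V g (zero_ext V X h))"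
proof -
  have "adj d V V (shift d V X h) \<phi> g = (\<Sum>k\<in>cfg d V. cnj (ket (cfg_add d V g (zero_ext V X h)) k)
    * \<phi> k)"
    using g unfolding adj_eq[OF shift_operator[OF d] V] by (simp add: shift_def lin_ket[OF V g])
  also have "\<dots> = (\<Sum>k\<in>cfg d V. if k = cfg_add d V g (zero_ext V X h)
      then \<phi> (cfg_add d V g (zero_ext V X h)) else 0)"
    by (rule sum.cong) (auto simp: ket_def)
  finally show ?thesis by (simp add: finite_cfg[OF V] cfg_add_closed[OF d])
qed

text \<open>Adding \<open>h\<close> to the zero entries writes \<open>h\<close> on \<open>X\<close>;
  the reductions modulo \<open>d\<close> change nothing because all entries are already
  residues.\<close>

lemma cfg_add_override:
  assumes X: "X \<subseteq> V" and g: "g \<in> cfg d (V - X)" and h: "h \<in> cfg d X"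
  shows "cfg_add d V (override_on g (\<lambda>i\<in>X. 0) X) (zero_ext V X h) = override_on g h X"
proof
  fix i
  have "h i mod int d = h i" if "i \<in> X" using cfg_Zd[OF h that] by (simp add: Zd_def)
  moreover have "g i mod int d = g i" if "i \<in> V - X" using cfg_Zd[OF g that] by (simp add: Zd_def)
  moreover have "g i = undefined" if "i \<notin> V" using g that
    by (auto simp: cfg_def PiE_def extensional_def)
  ultimately show "cfg_add d V (override_on g (\<lambda>i\<in>X. 0) X) (zero_ext V X h) i = override_on g h X i"
    using X by (auto simp: cfg_add_def zero_ext_def override_on_def)
qed

text \<open>The adjoint of the operator \<open>B\<^sub>h\<close> of the overview: undoing the shift
  and projecting onto zero selects the components with \<open>X\<close>-part
  \<open>h\<close>.\<close>

lemma shift_embed_adj_apply: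
  assumes d: "d > 0" and V: "finite V" and X: "X \<subseteq> V" and h: "h \<in> cfg d X"
  shows "adj d (V - X) V (shift d V X h \<circ> embed d V X) \<phi> g
    = (if g \<in> cfg d (V - X) then \<phi> (override_on g h X) else 0)"
proof -
  have "adj d (V - X) V (shift d V X h \<circ> embed d V X) \<phi>
    = embed_adj d V X (adj d V V (shift d V X h) \<phi>)"
    unfolding embed_adj_def using V
      by (intro adj_comp embed_operator[OF X] shift_operator[OF d]) auto
  then show ?thesis
    by (simp add: embed_adj_apply[OF d V X] shift_adj_apply[OF d V] cfg_add_override[OF X _ h]
        override_cfg_Diff[OF _ X zero_cfg[OF d]])
qed

lemma multiplier_apply:
  assumes X: "finite X" and \<psi>: "\<psi> \<in> l2 d X"
  shows "multiplier d X h \<psi> k = chi_on d X h k * \<psi> k"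
proof -
  have "multiplier d X h \<psi> k = (\<Sum>g\<in>cfg d X. if g = k then chi_on d X h k * \<psi> k else 0)"
    unfolding multiplier_def lin_def by (rule sum.cong) (auto simp: ket_def)
  then show ?thesis using \<psi> by (simp add: finite_cfg[OF X] l2_def)
qed

lemma graph_code_apply:
  assumes V: "finite V" and g: "g \<in> cfg d (V - X)"
  shows "graph_code d V X \<Gamma> \<psi> g = (\<Sum>h\<in>cfg d X. \<psi> h *
    (complex_of_real (real d powr ((1/2) * real (card X)))
      * wave_function d V \<Gamma> (override_on g h X)))"
proof -
  have "(\<Sum>g'\<in>cfg d (V - X). wave_function d V \<Gamma> (override_on g' h X) * ket g' g)
    = (\<Sum>g'\<in>cfg d (V - X). if g' = g then wave_function d V \<Gamma> (override_on g h X) else 0)" for h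
    by (rule sum.cong) (auto simp: ket_def)
  then show ?thesis using V g by (simp add: graph_code_def lin_def finite_cfg)
qed

section \<open>The circuit and the graph code\<close>

text \<open>The operator \<open>A\<close> of the overview, shared by both claims. For
  \<open>X \<subseteq> V\<close> it starts from \<open>l2 d X\<close>, since then
  \<open>V - (V - X) = X\<close>.\<close>

definition circuit :: "nat \<Rightarrow> 'v set \<Rightarrow> 'v set \<Rightarrow> ('v \<Rightarrow> 'v \<Rightarrow> int) \<Rightarrow> 'v oper" where
  "circuit d V X \<Gamma> = fourier_set d V X \<circ> cluster_op d V \<Gamma> \<circ> adj d V V (fourier_set d V X) \<circ>
     embed d V (V - X)"

text \<open>In the kernel sum only the zero configuration on \<open>Y\<close> survives, and its
  character is 1. The result is constant in the \<open>Y\<close>-entries: a uniform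
  superposition.\<close>

lemma fourier_embed_apply:
  assumes d: "d > 0" and V: "finite V" and Y: "Y \<subseteq> V" and \<psi>: "\<psi> \<in> l2 d (V - Y)"
    and k: "k \<in> cfg d V"
  shows "fourier_set d V Y (embed d V Y \<psi>) k
    = complex_of_real (1 / sqrt (real d)) ^ card Y * \<psi> (restrict k (V - Y))"
proof -
  have YV: "Y \<union> (V - Y) = V" using Y by blast
  have fY: "finite Y" using V Y by (rule rev_finite_subset)
  have "(\<Sum>g\<in>cfg d Y. chi_on d Y g k * embed d V Y \<psi> (override_on k g Y))
    = (\<Sum>g\<in>cfg d Y. if g = (\<lambda>i\<in>Y. 0) then \<psi> (restrict k (V - Y)) else 0)"
  proof (rule sum.cong[OF refl])
    fix g assume g: "g \<in> cfg d Y"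
    have "restrict (override_on k g Y) (V - Y) = restrict k (V - Y)"
      by (auto simp: fun_eq_iff restrict_def override_on_def)
    then have "embed d V Y \<psi> (override_on k g Y) = ket (\<lambda>i\<in>Y. 0) g * \<psi> (restrict k (V - Y))"
      unfolding embed_def tensor_vec_def YV by (simp add:
        override_cfg[OF k Y g] restrict_override[OF g])
    then show "chi_on d Y g k * embed d V Y \<psi> (override_on k g Y)
      = (if g = (\<lambda>i\<in>Y. 0) then \<psi> (restrict k (V - Y)) else 0)"
      by (simp add: ket_def chi_on_def)
  qed
  then show ?thesis
    by (simp add: fourier_set_apply[OF d V Y operators_closed[OF embed_operator[OF Y] \<psi>] k]
        finite_cfg[OF fY] zero_cfg[OF d])
qed

text \<open>Follows the vector through the gates in the order in which they act. The characters in
  the result come from the last transform over \<open>X\<close> alone.\<close>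

lemma circuit_apply:
  assumes d: "d > 0" and \<Gamma>: "weighted_graph V \<Gamma>" and X: "X \<subseteq> V" and \<psi>: "\<psi> \<in> l2 d X"
    and g: "g \<in> cfg d (V - X)" and h: "h \<in> cfg d X"
  shows "circuit d V X \<Gamma> \<psi> (override_on g h X) = complex_of_real (1 / sqrt (real d)) ^ card V *
    (\<Sum>h'\<in>cfg d X. chi_on d X h' h * (phase d \<Gamma> (pairs V) (override_on g h' X) * \<psi> h'))"
proof -
  let ?c = "complex_of_real (1 / sqrt (real d))"
  have V: "finite V" using \<Gamma> by (simp add: weighted_graph_def)
  have XX: "V - (V - X) = X" "(V - X) \<union> X = V" "(V - X) \<inter> X = {}" using X by auto
  have fX: "finite X" using V X by (rule rev_finite_subset)
  have e: "embed d V (V - X) \<psi> \<in> l2 d V"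
    by (rule operators_closed[OF embed_operator]) (simp_all add: XX \<psi>)
  let ?\<xi> = "adj d V V (fourier_set d V X) (embed d V (V - X) \<psi>)"
  have \<xi>: "?\<xi> \<in> l2 d V" by (rule adj_closed[OF fourier_set_operator[OF V X] V])
  have "fourier_set d V (V - X \<union> X) = fourier_set d V (V - X) \<circ> fourier_set d V X"
    by (rule fourier_set_union[OF V _ XX(3)]) (simp add: X)
  \<comment> \<open>Here the transforms over \<open>X\<close> cancel, leaving those over
    \<open>V - X\<close> acting on the embedded input.\<close>
  then have FV: "fourier_set d V V ?\<xi> = fourier_set d V (V - X) (embed d V (V - X) \<psi>)"
    unfolding XX(2) by (simp only: o_apply fourier_set_unitary[OF d V X e])
  have c: "cluster_op d V \<Gamma> ?\<xi> k
      = phase d \<Gamma> (pairs V) k * (?c ^ card (V - X) * \<psi> (restrict k X))" if "k \<in> cfg d V" for k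
    using fourier_embed_apply[OF d V Diff_subset[of V X] _ that, unfolded XX(1), OF \<psi>]
    by (simp add: cluster_op_apply[OF d \<Gamma> \<xi>] FV)
  have ov: "override_on (override_on g h X) h' X = override_on g h' X" for h'
    by (auto simp: override_on_def)
  have "circuit d V X \<Gamma> \<psi> (override_on g h X)
    = fourier_set d V X (cluster_op d V \<Gamma> ?\<xi>) (override_on g h X)"
    by (simp add: circuit_def)
  also have "\<dots> = ?c ^ card X * (\<Sum>h'\<in>cfg d X. chi_on d X h' (override_on g h X) *
      cluster_op d V \<Gamma> ?\<xi> (override_on g h' X))"
    unfolding fourier_set_apply[OF d V X operators_closed[OF cluster_op_operator[OF d \<Gamma>] \<xi>]
      override_cfg_Diff[OF g X h]] ov ..
  also have "\<dots> = ?c ^ card X * (\<Sum>h'\<in>cfg d X. chi_on d X h' h *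
      (phase d \<Gamma> (pairs V) (override_on g h' X) * (?c ^ card (V - X) * \<psi> h')))"
    by (intro arg_cong2[where f = "(*)"] sum.cong refl)
      (simp_all add: c override_cfg_Diff[OF g X] restrict_override chi_on_def)
  also have "\<dots> = ?c ^ (card X + card (V - X)) * (\<Sum>h'\<in>cfg d X. chi_on d X h' h *
      (phase d \<Gamma> (pairs V) (override_on g h' X) * \<psi> h'))"
    by (simp only: power_add sum_distrib_left mult_ac)
  \<comment> \<open>The last transform and the one over \<open>V - X\<close> together supply the
    exponent \<open>card V\<close> of the wave function.\<close>
  also have "card X + card (V - X) = card V"
    using V X fX by (simp add: card_Diff_subset card_mono)
  finally show ?thesis .
qed

text \<open>Matches the product of Fourier normalisations with the real power in
  \<open>wave_function\<close>.\<close>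

lemma inverse_sqrt_power:
  assumes "d > 0"
  shows "complex_of_real (1 / sqrt (real d)) ^ n = complex_of_real (real d powr (- (1/2) * real n))"
proof -
  have "1 / sqrt (real d) = real d powr (- (1/2))"
    using powr_half_sqrt[of "real d"] powr_minus_divide[of "real d" "1/2"] by simp
  moreover have "(real d powr (- (1/2))) ^ n = (real d powr (- (1/2))) powr real n"
    using assms by (subst powr_realpow) simp_all
  ultimately have "(1 / sqrt (real d)) ^ n = real d powr (- (1/2) * real n)"
    by (simp only: powr_powr)
  then show ?thesis by (simp only: of_real_power[symmetric])
qed

lemma circuit_operator:
  assumes d: "d > 0" and \<Gamma>: "weighted_graph V \<Gamma>" and X: "X \<subseteq> V"
  shows "circuit d V X \<Gamma> \<in> operators d X V"
proof -
  have V: "finite V" using \<Gamma> by (simp add: weighted_graph_def)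
  have "V - (V - X) = X" using X by auto
  then have "embed d V (V - X) \<in> operators d X V" using embed_operator[of "V - X" V d] by simp
  then show ?thesis unfolding circuit_def
    by (intro comp_operator[where L = V] fourier_set_operator[OF V X] cluster_op_operator[OF d \<Gamma>]
        adj_operator[OF _ V])
qed

lemma shift_embed_operator:
  assumes "d > 0" and "X \<subseteq> V"
  shows "shift d V X h \<circ> embed d V X \<in> operators d (V - X) V"
  by (rule comp_operator[OF shift_operator[OF assms(1)] embed_operator[OF assms(2)]])

text \<open>The identity behind both claims. At \<open>X\<close>-part \<open>h\<close> the kernel of
  the circuit is the wave function times \<open>chi_on d X h' h\<close>, which is the multiplier of
  \<open>h\<close> acting before the graph code; the scalar is the normalisation of
  \<open>graph_code\<close>.\<close>

lemma graph_code_multiplier: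
  assumes d: "d > 0" and \<Gamma>: "weighted_graph V \<Gamma>" and X: "X \<subseteq> V" and \<psi>: "\<psi> \<in> l2 d X"
    and h: "h \<in> cfg d X"
  shows "graph_code d V X \<Gamma> (multiplier d X h \<psi>) =
    op_scale (complex_of_real (real d powr (real (card X) / 2)))
      (adj d (V - X) V (shift d V X h \<circ> embed d V X) \<circ> circuit d V X \<Gamma>) \<psi>"
proof
  fix g
  have V: "finite V" using \<Gamma> by (simp add: weighted_graph_def)
  have fX: "finite X" using V X by (rule rev_finite_subset)
  have G: "graph_code d V X \<Gamma> (multiplier d X h \<psi>) \<in> l2 d (V - X)"
    by (intro operators_closed[OF graph_code_operator] operators_closed[OF multiplier_operator] \<psi>)
  show "graph_code d V X \<Gamma> (multiplier d X h \<psi>) g =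
    op_scale (complex_of_real (real d powr (real (card X) / 2)))
      (adj d (V - X) V (shift d V X h \<circ> embed d V X) \<circ> circuit d V X \<Gamma>) \<psi> g"
  proof (cases "g \<in> cfg d (V - X)")
    case True
    show ?thesis
      by (simp add: op_scale_def shift_embed_adj_apply[OF d V X h] True
          circuit_apply[OF d \<Gamma> X \<psi> True h, unfolded inverse_sqrt_power[OF d]]
          graph_code_apply[OF V True] wave_function_phase multiplier_apply[OF fX \<psi>]
          chi_on_commute[of _ _ h] sum_distrib_left mult_ac)
  next
    case False
    then show ?thesis using G by (simp add: op_scale_def shift_embed_adj_apply[OF d V X h] l2_def)
  qed
qed

text \<open>The adjoint of \<open>graph_code_multiplier\<close>: the scalar is real, hence its own
  conjugate, and the double adjoint of shift after embedding returns that operator.\<close>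

lemma adj_graph_code_multiplier:
  assumes d: "d > 0" and \<Gamma>: "weighted_graph V \<Gamma>" and X: "X \<subseteq> V" and \<phi>: "\<phi> \<in> l2 d (V - X)"
    and h: "h \<in> cfg d X"
  shows "adj d X X (multiplier d X h) (adj d X (V - X) (graph_code d V X \<Gamma>) \<phi>) =
    (\<lambda>g. complex_of_real (real d powr (real (card X) / 2)) *
      adj d X V (circuit d V X \<Gamma>) (shift d V X h (embed d V X \<phi>)) g)"
proof -
  have V: "finite V" using \<Gamma> by (simp add: weighted_graph_def)
  have fX: "finite X" using V X by (rule rev_finite_subset)
  have fY: "finite (V - X)" using V by simp
  let ?B = "shift d V X h \<circ> embed d V X" and ?s
    = "complex_of_real (real d powr (real (card X) / 2))"
  note B = shift_embed_operator[OF d X, of h]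
  note B' = adj_operator[OF B fY] and A = circuit_operator[OF d \<Gamma> X]
  have "adj d X X (multiplier d X h) (adj d X (V - X) (graph_code d V X \<Gamma>) \<phi>)
      = adj d X (V - X) (graph_code d V X \<Gamma> \<circ> multiplier d X h) \<phi>"
    by (rule adj_comp[OF multiplier_operator graph_code_operator fX fX, symmetric])
  \<comment> \<open>The two operators agree on \<open>l2 d X\<close>, which suffices under
    \<open>adj\<close>.\<close>
  also have "adj d X (V - X) (graph_code d V X \<Gamma> \<circ> multiplier d X h)
      = adj d X (V - X) (op_scale ?s (adj d (V - X) V ?B \<circ> circuit d V X \<Gamma>))"
    by (rule adj_cong) (simp add: graph_code_multiplier[OF d \<Gamma> X _ h, unfolded o_def] o_def)
  also have "\<dots> \<phi> = (\<lambda>g. ?s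
    * adj d X V (circuit d V X \<Gamma>) (adj d V (V - X) (adj d (V - X) V ?B) \<phi>) g)"
    by (simp only: adj_op_scale[OF comp_operator[OF B' A] fX] adj_comp[OF A B' fX V]
      complex_cnj_complex_of_real)
  also have "adj d V (V - X) (adj d (V - X) V ?B) \<phi> = ?B \<phi>"
    by (rule adj_adj[OF B fY V \<phi>])
  finally show ?thesis by simp
qed

text \<open>The right side is what \<open>P_op\<close> and \<open>alpha\<close> place to the left of
  their argument \<open>b\<close>, so together they send \<open>b\<close> to \<open>b\<close>
  conjugated by the circuit.\<close>

lemma adj_circuit:
  assumes d: "d > 0" and \<Gamma>: "weighted_graph V \<Gamma>" and X: "X \<subseteq> V"
  shows "adj d X V (circuit d V X \<Gamma>) \<phi> = embed_adj d V (V - X) (fourier_set d V X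
    (adj d V V (cluster_op d V \<Gamma>) (adj d V V (fourier_set d V X) \<phi>)))"
proof -
  have V: "finite V" using \<Gamma> by (simp add: weighted_graph_def)
  have fX: "finite X" using V X by (rule rev_finite_subset)
  have XX: "V - (V - X) = X" using X by auto
  have w: "embed d V (V - X) \<in> operators d X V" using embed_operator[of "V - X" V d]
    by (simp add: XX)
  note F = fourier_set_operator[OF V X, of d] and U = cluster_op_operator[OF d \<Gamma>]
  note F' = adj_operator[OF F V]
  have "adj d X V (circuit d V X \<Gamma>) \<phi>
    = adj d X V (embed d V (V - X)) (adj d V V (adj d V V (fourier_set d V X))
    (adj d V V (cluster_op d V \<Gamma>) (adj d V V (fourier_set d V X) \<phi>)))"
    unfolding circuit_def
    by (simp only: adj_comp[OF w comp_operator[OF comp_operator[OF F U] F'] fX V]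
        adj_comp[OF F' comp_operator[OF F U] V V] adj_comp[OF U F V V])
  then show ?thesis
    by (simp add: adj_adj[OF F V V adj_closed[OF U V]] embed_adj_def XX)
qed

section \<open>The coding operation on indicator tensors and the two claims\<close>

lemma coding_elem_ket:
  assumes X: "finite X" and k: "k \<in> cfg d X"
  shows "coding_elem d V X \<Gamma> a (ket k) \<psi> g = 1 / of_nat d ^ card X *
    adj d X X (multiplier d X k) (adj d X (V - X) (graph_code d V X \<Gamma>)
      (a (graph_code d V X \<Gamma> (multiplier d X k \<psi>)))) g"
proof -
  let ?R = "\<lambda>h. adj d X X (multiplier d X h) (adj d X (V - X) (graph_code d V X \<Gamma>)
      (a (graph_code d V X \<Gamma> (multiplier d X h \<psi>)))) g"
  have "(\<Sum>h\<in>cfg d X. ket k h * ?R h) = (\<Sum>h\<in>cfg d X. if h = k then ?R k else 0)"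
    by (rule sum.cong) (auto simp: ket_def)
  then show ?thesis using k finite_cfg[OF X] by (simp add: coding_elem_def op_scale_def op_sum_def)
qed

text \<open>As in \<open>coding_elem_ket\<close>, the indicator \<open>ket k\<close> supplied by
  \<open>tensor_ext\<close> keeps one summand. The two rightmost adjoints are merged to match
  \<open>graph_code_multiplier\<close>.\<close>

lemma M_elem_ket:
  assumes d: "d > 0" and V: "finite V" and X: "X \<subseteq> V" and k: "k \<in> cfg d X"
  shows "M_elem d V X a (ket k) \<psi> g = shift d V X k (embed d V X
    (a (adj d (V - X) V (shift d V X k \<circ> embed d V X) \<psi>))) g"
proof -
  have fX: "finite X" using V X by (rule rev_finite_subset)
  have adj: "adj d (V - X) V (shift d V X k \<circ> embed d V X) \<psi>
      = embed_adj d V X (adj d V V (shift d V X k) \<psi>)"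
    unfolding embed_adj_def using V
      by (intro adj_comp embed_operator[OF X] shift_operator[OF d]) auto
  let ?R = "\<lambda>h. shift d V X h (embed d V X (a (embed_adj d V X (adj d V V (shift d V X h) \<psi>)))) g"
  have "(\<Sum>h\<in>cfg d X. ket k h * ?R h) = (\<Sum>h\<in>cfg d X. if h = k then ?R k else 0)"
    by (rule sum.cong) (auto simp: ket_def)
  then show ?thesis
    unfolding adj using k finite_cfg[OF fX] by (simp add: M_elem_def op_scale_def op_sum_def)
qed

lemma graph_code_eq:
  assumes d: "d > 0" and \<Gamma>: "weighted_graph V \<Gamma>" and X: "X \<subseteq> V" and \<psi>: "\<psi> \<in> l2 d X"
  shows "graph_code d V X \<Gamma> \<psi> = op_scale (complex_of_real (real d powr (real (card X) / 2)))
    (embed_adj d V X \<circ> circuit d V X \<Gamma>) \<psi>"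
proof -
  let ?z = "\<lambda>i\<in>X. 0 :: int"
  have V: "finite V" using \<Gamma> by (simp add: weighted_graph_def)
  have fX: "finite X" using V X by (rule rev_finite_subset)
  have "multiplier d X ?z \<psi> = \<psi>"
    by (rule ext) (simp add: multiplier_apply[OF fX \<psi>] chi_on_def)
  \<comment> \<open>The shift by zero disappears because both sides evaluate at the extension by
    zeros on \<open>X\<close>.\<close>
  moreover have "adj d (V - X) V (shift d V X ?z \<circ> embed d V X) = embed_adj d V X"
    by (intro ext) (simp only: shift_embed_adj_apply[OF d V X zero_cfg[OF d]] embed_adj_apply[OF d
      V X])
  ultimately show ?thesis using graph_code_multiplier[OF d \<Gamma> X \<psi> zero_cfg[OF d]] by simp
qed

text \<open>The identity is checked for each \<open>k\<close> separately and then summed, the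
  adjoint of the circuit being linear.\<close>

lemma coding_eq:
  assumes d: "d > 0" and \<Gamma>: "weighted_graph V \<Gamma>" and X: "X \<subseteq> V" and \<psi>: "\<psi> \<in> l2 d X"
    and T: "T \<in> tensor_alg d (V - X) X"
  shows "coding d V X \<Gamma> T \<psi> = P_op d V (V - X) (alpha d V X \<Gamma> (M_op d V X T)) \<psi>"
proof -
  have V: "finite V" using \<Gamma> by (simp add: weighted_graph_def)
  have fX: "finite X" using V X by (rule rev_finite_subset)
  have fY: "finite (V - X)" using V by simp
  let ?A = "circuit d V X \<Gamma>" and ?s = "complex_of_real (real d powr (real (card X) / 2))"
  let ?B = "\<lambda>k. shift d V X k \<circ> embed d V X"
  let ?N = "\<lambda>k. ?B k (T k (adj d (V - X) V (?B k) (?A \<psi>)))"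
  note A = circuit_operator[OF d \<Gamma> X] and B = shift_embed_operator[OF d X]
  have Tk: "T k \<in> operators d (V - X) (V - X)" if "k \<in> cfg d X" for k
    using T that by (auto simp: tensor_alg_def)
  \<comment> \<open>One factor \<open>?s\<close> comes from the graph code and one from its adjoint;
    together they cancel the prefactor of \<open>coding_elem\<close>.\<close>
  have s2: "?s * ?s = of_nat d ^ card X"
  proof -
    have "real d powr (real (card X) / 2) * real d powr (real (card X) / 2) = real d ^ card X"
      using d by (simp add: powr_add[symmetric] powr_realpow)
    then show ?thesis by (simp only: of_real_mult[symmetric]) simp
  qed
  have mem: "adj d (V - X) V (?B k) \<phi> \<in> l2 d (V - X)" for k \<phi>
    by (rule adj_closed[OF B fY])
  have N: "?N k \<in> l2 d V" if "k \<in> cfg d X" for k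
    by (rule operators_closed[OF B operators_closed[OF Tk[OF that] mem]])
  have elem: "coding_elem d V X \<Gamma> (T k) (ket k) \<psi> g = adj d X V ?A (?N k) g"
    if k: "k \<in> cfg d X" for k g
  proof -
    let ?\<phi> = "adj d (V - X) V (?B k) (?A \<psi>)"
    \<comment> \<open>Linearity of \<open>T k\<close> moves the first factor \<open>?s\<close>
      outside.\<close>
    have "T k (graph_code d V X \<Gamma> (multiplier d X k \<psi>)) = (\<lambda>g. ?s * T k ?\<phi> g)"
      unfolding graph_code_multiplier[OF d \<Gamma> X \<psi> k]
      using operators_scale[OF Tk[OF k] mem] by (simp add: op_scale_def[abs_def])
    moreover have "(\<lambda>g. ?s * T k ?\<phi> g) \<in> l2 d (V - X)"
      using operators_closed[OF Tk[OF k] mem] by (simp add: l2_def)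
    ultimately have "coding_elem d V X \<Gamma> (T k) (ket k) \<psi> g
      = 1 / of_nat d ^ card X * (?s * adj d X V ?A (?B k (\<lambda>g. ?s * T k ?\<phi> g)) g)"
      by (simp add: coding_elem_ket[OF fX k] adj_graph_code_multiplier[OF d \<Gamma> X _ k])
    also have "adj d X V ?A (?B k (\<lambda>g. ?s * T k ?\<phi> g)) g = ?s * adj d X V ?A (?N k) g"
      unfolding operators_scale[OF B operators_closed[OF Tk[OF k] mem]]
      by (simp only: adj_scale[OF A fX])
    also have "1 / of_nat d ^ card X * (?s * (?s * adj d X V ?A (?N k) g)) = adj d X V ?A (?N k) g"
      using s2 d by (simp add: mult.assoc[symmetric])
    finally show ?thesis .
  qed
  have "P_op d V (V - X) (alpha d V X \<Gamma> (M_op d V X T)) \<psi> = embed_adj d V (V - X) (fourier_set d V X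
      (adj d V V (cluster_op d V \<Gamma>) (adj d V V (fourier_set d V X) (M_op d V X T (?A \<psi>)))))"
    by (simp add: P_op_def alpha_def circuit_def)
  also have "\<dots> = adj d X V ?A (M_op d V X T (?A \<psi>))"
    by (rule adj_circuit[OF d \<Gamma> X, symmetric])
  also have "M_op d V X T (?A \<psi>) = (\<lambda>g. \<Sum>k\<in>cfg d X. ?N k g)"
    by (simp add: M_op_def tensor_ext_def op_sum_def[abs_def] M_elem_ket[OF d V X])
  also have "adj d X V ?A \<dots> = (\<lambda>g. \<Sum>k\<in>cfg d X. adj d X V ?A (?N k) g)"
    by (rule operators_sum[OF adj_operator[OF A fX] finite_cfg[OF fX] N])
  also have "\<dots> = coding d V X \<Gamma> T \<psi>"
    by (simp add: coding_def tensor_ext_def op_sum_def[abs_def] elem)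
  finally show ?thesis ..
qed

theorem mainTheorem2:
  fixes d :: nat and V X Y :: "'v set" and \<Gamma> :: "'v \<Rightarrow> 'v \<Rightarrow> int"
  assumes "d > 0"
    and "weighted_graph V \<Gamma>"
    and "V = X \<union> Y" and "X \<inter> Y = {}"
    and "is_isometry d X Y (graph_code d V X \<Gamma>)"
  shows "(\<forall>\<psi>\<in>l2 d X. graph_code d V X \<Gamma> \<psi> =
           op_scale (complex_of_real (real d powr (real (card X) / 2)))
             (embed_adj d V X \<circ> fourier_set d V X \<circ> cluster_op d V \<Gamma> \<circ>
              adj d V V (fourier_set d V X) \<circ> embed d V Y) \<psi>)
       \<and> (\<forall>T\<in>tensor_alg d Y X. \<forall>\<psi>\<in>l2 d X.
           coding d V X \<Gamma> T \<psi> = (P_op d V Y \<circ> alpha d V X \<Gamma> \<circ> M_op d V X) T \<psi>)"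
proof -
  have X: "X \<subseteq> V" and Y: "Y = V - X" using assms(3,4) by auto
  show ?thesis
    unfolding Y using graph_code_eq[OF assms(1,2) X] coding_eq[OF assms(1,2) X]
    by (simp add: circuit_def o_assoc)
qed

end
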